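(* Let $\mathcal{K}\subset\mathbb{R}$ be a closed interval containing $0$, or $\mathbb{R}^+$, or $\mathbb{R}$. Let $f\colon\mathbb{S}^1\to\mathbb{S}^1$ be a continuous circle map of degree one with a lifting $F$ such that $\mathrm{Rot}_I(F)$, the set of irrational numbers in the rotation set $\mathrm{Rot}(F)$, is non-empty. Let $q\colon\mathbb{S}^1\to\mathcal{K}$ and $p\colon\mathcal{K}\to\mathcal{K}$ be continuous maps such that $p(x)q(\theta)\in\mathcal{K}$ for all $x\in\mathcal{K}$, $\theta\in\mathbb{S}^1$, and let $T\colon\mathbb{S}^1\times\mathcal{K}\to\mathbb{S}^1\times\mathcal{K}$ be the skew-product $T(\theta,x)=(f(\theta),\,p(x)q(\theta))$. Then to every $\rho\in\mathrm{Rot}_I(F)$ one can associate a measurable $f$-invariant set $\mathscr{U}_\rho\subset\mathbb{S}^1$, a continuous non-decreasing circle map $h_\rho$ of degree one, and an $f$-ergodic measure $\mu_\rho$ such that all of the following hold. (1) For every $\rho\in\mathrm{Rot}_I(F)$: $\mu_\rho(\mathscr{U}_\rho)=1$; $\rho_F(x)=\rho$ for every $x\in e^{-1}(\mathrm{Cl}(\mathscr{U}_\rho))$; the restriction $h_\rho|_{\mathscr{U}_\rho}\colon\mathscr{U}_\rho\to h_\rho(\mathscr{U}_\rho)$ is a homeomorphism; and $h_\rho(\mathscr{U}_\rho)$ is a dense subset of $\mathbb{S}^1$ which is $\Phi_\rho$-invariant, where $\Phi_\rho(\theta)=\theta+\rho \pmod 1$. (2) The sets $\mathrm{Cl}(\mathscr{U}_\rho)$,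 $\rho\in\mathrm{Rot}_I(F)$, are pairwise disjoint. (3) Assume that, for every $\rho\in\mathrm{Rot}_I(F)$, the system $$S_\rho(\theta,x)=\bigl(\Phi_\rho(\theta),\;p(x)\,q(h_\rho^{-1}(\theta))\bigr)$$ has an attracting set with support $h_\rho(\mathscr{U}_\rho)$ which is the closure of the graph of a correspondence $\varphi_\rho\colon h_\rho(\mathscr{U}_\rho)\to\mathcal{K}$. Then, for every $\rho\in\mathrm{Rot}_I(F)$, the closure of the graph of $\varphi_\rho\circ h_\rho$ (a correspondence from $\mathscr{U}_\rho$ to $\mathcal{K}$) is an attracting set of $T$ with support $\mathscr{U}_\rho$. Thus, whenever $\mathrm{Rot}(F)$ is non-degenerate (not a single point), $T$ has uncountably many coexisting attracting sets.
   Context: Circle maps and liftings. $\mathbb{S}^1=\mathbb{R}/\mathbb{Z}$, with points identified with their representatives in $[0,1)$, and $e\colon\mathbb{R}\to\mathbb{S}^1$ is the natural projection (fractional part). A lifting of a continuous circle map $f$ is a continuous $F\colon\mathbb{R}\to\mathbb{R}$ with $f\circ e=e\circ F$; $f$ has degree $d\in\mathbb{Z}$ if $F(x+1)=F(x)+d$ for all $x\in\mathbb{R}$. A circle map is non-decreasing if it has a non-decreasing lifting. $\mathrm{Cl}(X)$ denotes the closure of $X$. Rotation numbers. For a lifting $F$ of a continuous degree one circle map and $x\in\mathbb{R}$, the $F$-rotation number of $x$ is $\rho_F(x)=\limsup_{n\to\infty}\frac{F^n(x)-x}{n}$, and the rotation set is $\mathrm{Rot}(F)=\{\rho_F(x):x\in\mathbb{R}\}$,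 which is known to be a closed interval of $\mathbb{R}$. Invariance and measures. A set $A$ is $f$-invariant if $f(A)=A$ (and likewise for other maps). An $f$-ergodic measure is an $f$-invariant ergodic Borel probability measure on $\mathbb{S}^1$. Correspondences and attracting sets. A correspondence $\varphi\colon\mathscr{U}\to\mathcal{K}$ assigns to each $\theta\in\mathscr{U}$ a non-empty subset $\varphi(\theta)\subset\mathcal{K}$; its graph is $\mathrm{graph}(\varphi)=\{(\theta,x):\theta\in\mathscr{U},\,x\in\varphi(\theta)\}$; and $(\varphi_\rho\circ h_\rho)(\theta)=\varphi_\rho(h_\rho(\theta))$. Let $R$ be a skew-product over a base circle map $g$, let $\mu$ be an ergodic measure of $g$, let $\mathscr{U}\subset\mathbb{S}^1$ be a measurable $g$-invariant set with $\mu(\mathscr{U})=1$, and let $\varphi\colon\mathscr{U}\to\mathcal{K}$ be a correspondence whose graph is $R$-invariant, i.e. $R(\mathrm{graph}(\varphi))=\mathrm{graph}(\varphi)$. The closure of $\mathrm{graph}(\varphi)$ is called an attracting set of $R$ with support $\mathscr{U}$ and generated by $\varphi$ if, for every $\theta\in\mathscr{U}$ and every $x$ in a subset of $\mathcal{K}$ of positive Lebesgue measure, there is some $z(x)\in\varphi(\theta)$ with $$\lim_{n\to\infty}\|R^n(\theta,x)-R^n(\theta,z(x))\|=0.$$ (The two points $R^n(\theta,x)$ and $R^n(\theta,z(x))$ have the same first coordinate, so the norm is the absolute value of the difference of their second coordinates.) This notion is applied to $T$ (base map $f$) and to $S_\rho$ (base map $\Phi_\rho$). In the definition of $S_\rho$,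 $h_\rho^{-1}$ denotes the inverse of the homeomorphism $h_\rho|_{\mathscr{U}_\rho}\colon\mathscr{U}_\rho\to h_\rho(\mathscr{U}_\rho)$; only the action of $S_\rho$ on $h_\rho(\mathscr{U}_\rho)\times\mathcal{K}$ is relevant for attracting sets with support $h_\rho(\mathscr{U}_\rho)$. *)

theory Defs
  imports "HOL-Probability.Probability"
begin

typedef circle = "{0..<1::real}"
  morphisms rep_circle Abs_circle
  by (rule exI[of _ 0]) simp

definition circle_proj :: "real \<Rightarrow> circle" where
  "circle_proj x = Abs_circle (frac x)"

text \<open>The topology is the quotient topology of \<open>\<real>/\<int>\<close>, not the subspace topology of \<open>[0,1)\<close>.\<close>

instantiation circle :: topological_space
begin

definition open_circle :: "circle set \<Rightarrow> bool" where
  "open_circle V \<longleftrightarrow> open (circle_proj -` V)"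

instance
  by standard (auto simp: open_circle_def vimage_Union)

end

definition circle_rotation :: "real \<Rightarrow> circle \<Rightarrow> circle" where
  "circle_rotation \<rho> \<theta> = circle_proj (rep_circle \<theta> + \<rho>)"

definition lifting :: "(circle \<Rightarrow> circle) \<Rightarrow> (real \<Rightarrow> real) \<Rightarrow> bool" where
  "lifting f F \<longleftrightarrow> continuous_on UNIV F \<and> f \<circ> circle_proj = circle_proj \<circ> F"

text \<open>Two liftings of the same map differ by an integer constant, so the choice of the
  lifting is irrelevant in the following definition.\<close>

definition has_degree :: "(circle \<Rightarrow> circle) \<Rightarrow> int \<Rightarrow> bool" where
  "has_degree f d \<longleftrightarrow> (\<exists>F. lifting f F \<and> (\<forall>x. F (x + 1) = F x + of_int d))"

definition nondecreasing_circle_map :: "(circle \<Rightarrow> circle) \<Rightarrow> bool" where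
  "nondecreasing_circle_map f \<longleftrightarrow> (\<exists>F. lifting f F \<and> mono F)"

text \<open>For a lifting \<open>F\<close> of a degree one map the sequence is bounded, so the upper limit is
  finite and the conversion from \<^typ>\<open>ereal\<close> loses nothing.\<close>

definition rotation_number :: "(real \<Rightarrow> real) \<Rightarrow> real \<Rightarrow> real" where
  "rotation_number F x = real_of_ereal (limsup (\<lambda>n. ereal (((F ^^ n) x - x) / real n)))"

definition rotation_set :: "(real \<Rightarrow> real) \<Rightarrow> real set" where
  "rotation_set F = range (rotation_number F)"

definition irrational_rotation_set :: "(real \<Rightarrow> real) \<Rightarrow> real set" where
  "irrational_rotation_set F = rotation_set F - \<rat>"

definition invariant_set :: "('a \<Rightarrow> 'a) \<Rightarrow> 'a set \<Rightarrow> bool" where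
  "invariant_set f A \<longleftrightarrow> f ` A = A"

definition ergodic_measure :: "(circle \<Rightarrow> circle) \<Rightarrow> circle measure \<Rightarrow> bool" where
  "ergodic_measure f \<mu> \<longleftrightarrow>
     prob_space \<mu> \<and> sets \<mu> = sets borel \<and> f \<in> borel_measurable borel \<and>
     (\<forall>A\<in>sets borel. emeasure \<mu> (f -` A) = emeasure \<mu> A) \<and>
     (\<forall>A\<in>sets borel. f -` A = A \<longrightarrow> emeasure \<mu> A = 0 \<or> emeasure \<mu> A = 1)"

definition skew_prod :: "(circle \<Rightarrow> circle) \<Rightarrow> (real \<Rightarrow> real) \<Rightarrow> (circle \<Rightarrow> real) \<Rightarrow>
    circle \<times> real \<Rightarrow> circle \<times> real" where
  "skew_prod g p q = (\<lambda>(\<theta>, x). (g \<theta>, p x * q \<theta>))"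

definition correspondence :: "circle set \<Rightarrow> real set \<Rightarrow> (circle \<Rightarrow> real set) \<Rightarrow> bool" where
  "correspondence U K \<phi> \<longleftrightarrow> (\<forall>\<theta>\<in>U. \<phi> \<theta> \<noteq> {} \<and> \<phi> \<theta> \<subseteq> K)"

definition graph_corr :: "circle set \<Rightarrow> (circle \<Rightarrow> real set) \<Rightarrow> (circle \<times> real) set" where
  "graph_corr U \<phi> = (SIGMA \<theta>:U. \<phi> \<theta>)"

text \<open>\<open>generates_attracting_set g R K U \<phi>\<close>: the closure of the graph of \<open>\<phi>\<close> is an attracting set
  of \<open>R\<close> with support \<open>U\<close> and generated by \<open>\<phi>\<close>. Only the action of \<open>R\<close> on \<open>U \<times> K\<close> matters.
  The set \<open>B\<close> of attracted points may depend on the fibre. As \<open>R\<close> is a skew-product, the two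
  orbits being compared have the same first coordinates.\<close>

definition generates_attracting_set ::
    "(circle \<Rightarrow> circle) \<Rightarrow> (circle \<times> real \<Rightarrow> circle \<times> real) \<Rightarrow> real set \<Rightarrow>
     circle set \<Rightarrow> (circle \<Rightarrow> real set) \<Rightarrow> bool" where
  "generates_attracting_set g R K U \<phi> \<longleftrightarrow>
     (\<forall>\<theta>\<in>U. \<forall>x\<in>K. fst (R (\<theta>, x)) = g \<theta> \<and> snd (R (\<theta>, x)) \<in> K) \<and>
     U \<in> sets borel \<and> invariant_set g U \<and>
     (\<exists>\<mu>. ergodic_measure g \<mu> \<and> emeasure \<mu> U = 1) \<and>
     correspondence U K \<phi> \<and> invariant_set R (graph_corr U \<phi>) \<and>
     (\<forall>\<theta>\<in>U. \<exists>B\<in>sets lebesgue. B \<subseteq> K \<and> emeasure lebesgue B > 0 \<and>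
        (\<forall>x\<in>B. \<exists>z\<in>\<phi> \<theta>. (\<lambda>n. \<bar>snd ((R ^^ n) (\<theta>, x)) - snd ((R ^^ n) (\<theta>, z))\<bar>) \<longlonglongrightarrow> 0))"

text \<open>The closure is taken in \<open>circle \<times> \<real>\<close>; for closed \<open>K\<close> it agrees with the closure in
  \<open>circle \<times> K\<close>.\<close>

definition attracting_set ::
    "(circle \<Rightarrow> circle) \<Rightarrow> (circle \<times> real \<Rightarrow> circle \<times> real) \<Rightarrow> real set \<Rightarrow>
     (circle \<times> real) set \<Rightarrow> bool" where
  "attracting_set g R K A \<longleftrightarrow>
     (\<exists>U \<phi>. generates_attracting_set g R K U \<phi> \<and> A = closure (graph_corr U \<phi>))"

end

theory Submission
  imports Defs
begin

text \<open>The map \<open>f\<close> need not be monotone, but for every irrational \<open>\<rho>\<close> in its rotation set it agrees, on a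
closed invariant set, with a nondecreasing circle map of rotation number \<open>\<rho>\<close>.
Pouring water over the graph of the lifting \<open>F\<close>, that is, passing to a
running supremum of \<open>F\<close> capped by a raised running infimum of \<open>F\<close>, produces a one-parameter family of
nondecreasing liftings; each of them agrees with \<open>F\<close> except where it is locally constant
(\<open>truncation_locally_constant\<close>). The family runs from a map below \<open>F\<close> to one above it, and rotating
slower than \<open>\<rho>\<close> and rotating faster than \<open>\<rho>\<close> are disjoint open conditions on the parameter. So some
member \<open>G\<close> does neither, and all its orbits then follow the translation by \<open>\<rho>\<close> up to a bounded error
(\<open>monotone_truncation_with_rotation_number\<close>).

Since \<open>\<rho>\<close> is irrational, the upper limit of \<open>(G ^^ n) x - n * \<rho>\<close> is a continuous nondecreasing function
\<open>H\<close> with \<open>H (G x) = H x + \<rho>\<close> (\<open>poincare_semiconjugacy\<close>). Only countably many of its fibres are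
nondegenerate. Let \<open>U\<close> consist of the points whose level avoids a countable rotation-invariant
set containing the levels of these fibres. On \<open>U\<close> the map \<open>h\<close> induced by \<open>H\<close> is a
homeomorphism onto its image, which
is a rotation-invariant dense set with countable complement. A plateau of \<open>G\<close> lies in one fibre of \<open>H\<close>,
so \<open>U\<close> avoids the open plateaus, and \<open>F = G\<close> holds on the closure of \<open>U\<close>. Hence \<open>U\<close> is invariant under
\<open>f\<close>, points of its closure have rotation number \<open>\<rho>\<close>, and the closures for different \<open>\<rho>\<close> are disjoint
since a point has only one rotation number. The image of Lebesgue measure under the inverse of \<open>h\<close> is
the required ergodic measure, by the ergodicity of irrational rotations
(\<open>irrational_rotation_ergodic\<close>).

Finally, \<open>h\<close> conjugates \<open>f\<close> on \<open>U\<close> to the rotation, and \<open>q \<circ> inv h\<close> is the forcing of the rotated system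
by definition; so the skew-products are conjugate over \<open>U\<close> by a map that fixes the second coordinate,
and attracting sets are transported (\<open>attracting_set_transfer\<close>). There are uncountably many of them
because between two different rotation numbers there are uncountably many irrational ones, all of which
are realised, and the resulting sets lie over disjoint closed sets.\<close>


section \<open>Liftings of degree one and their displacement\<close>

definition degree_one_lift :: "(real \<Rightarrow> real) \<Rightarrow> bool" where
  "degree_one_lift G \<longleftrightarrow> continuous_on UNIV G \<and> (\<forall>x. G (x + 1) = G x + 1)"

lemma degree_one_lift_continuous:
  "degree_one_lift G \<Longrightarrow> continuous_on S G"
  unfolding degree_one_lift_def by (metis continuous_on_subset subset_UNIV)

lemma degree_one_lift_add_1:
  "degree_one_lift G \<Longrightarrow> G (x + 1) = G x + 1"
  by (simp add: degree_one_lift_def)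

lemma degree_one_lift_add_int:
  assumes "\<And>x. G (x + 1) = G x + (1::real)"
  shows "G (x + of_int k) = G x + of_int k"
proof (induction k rule: int_induct[where k = 0])
  case (step1 i)
  then show ?case using assms[of "x + of_int i"] by (simp add: algebra_simps)
next
  case (step2 i)
  then show ?case using assms[of "x + of_int (i - 1)"] by (simp add: algebra_simps)
qed simp

lemma degree_one_lift_frac:
  assumes "\<And>x. G (x + 1) = G x + (1::real)"
  shows "G x - x = G (frac x) - frac x"
  using degree_one_lift_add_int[of G, OF assms, of "frac x" "\<lfloor>x\<rfloor>"]
  by (simp add: frac_def)

lemma degree_one_lift_funpow:
  assumes "degree_one_lift G"
  shows "degree_one_lift (G ^^ n)"
proof (induction n)
  case (Suc n)
  have "continuous_on UNIV (\<lambda>x. G ((G ^^ n) x))"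
    by (rule continuous_on_compose2[OF degree_one_lift_continuous degree_one_lift_continuous])
      (use assms Suc in auto)
  then show ?case using assms Suc by (simp add: degree_one_lift_def o_def)
qed (simp add: degree_one_lift_def)

lemma degree_one_lift_displacement_extrema:
  assumes "degree_one_lift G"
  obtains a b where "\<And>x. G a - a \<le> G x - x" "\<And>x. G x - x \<le> G b - b"
proof -
  have c: "continuous_on {0..1} (\<lambda>x. G x - x)"
    by (intro continuous_intros degree_one_lift_continuous assms)
  have fr: "G x - x = G (frac x) - frac x" "frac x \<in> {0..1}" for x
    using degree_one_lift_frac[of G x] assms frac_lt_1[of x]
    by (auto simp: degree_one_lift_def)
  from continuous_attains_inf[OF _ _ c] obtain a where "\<forall>y\<in>{0..1}. G a - a \<le> G y - y" by auto
  moreover from continuous_attains_sup[OF _ _ c] obtain b where "\<forall>y\<in>{0..1}. G y - y \<le> G b - b" by auto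
  ultimately show ?thesis using that[of a b] fr by metis
qed

lemma degree_one_lift_displacement_bounded:
  assumes "degree_one_lift G"
  obtains M where "M \<ge> 0" "\<And>x. \<bar>G x - x\<bar> \<le> M"
proof -
  obtain a b where ab: "\<And>x. G a - a \<le> G x - x" "\<And>x. G x - x \<le> G b - b"
    using degree_one_lift_displacement_extrema[OF assms] by blast
  have "\<bar>G x - x\<bar> \<le> \<bar>G a - a\<bar> + \<bar>G b - b\<bar>" for x
    using ab(1)[of x] ab(2)[of x] by linarith
  then show ?thesis using that[of "\<bar>G a - a\<bar> + \<bar>G b - b\<bar>"] by auto
qed

lemma funpow_displacement_bounded:
  assumes "\<And>x. \<bar>G x - x\<bar> \<le> (M::real)"
  shows "\<bar>(G ^^ n) x - x\<bar> \<le> real n * M"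
proof (induction n)
  case (Suc n)
  then show ?case using assms[of "(G ^^ n) x"] by (simp add: algebra_simps)
qed simp

lemma degree_one_lift_surj:
  assumes "degree_one_lift G"
  shows "surj G"
proof -
  obtain M where M: "M \<ge> 0" "\<And>x. \<bar>G x - x\<bar> \<le> M"
    using degree_one_lift_displacement_bounded[OF assms] by blast
  have "\<exists>x. G x = y" for y
  proof -
    have "G (y - M) \<le> y" "y \<le> G (y + M)"
      using M(2)[of "y - M"] M(2)[of "y + M"] by linarith+
    then have "\<exists>x\<ge>y - M. x \<le> y + M \<and> G x = y"
      using M(1) by (intro IVT' degree_one_lift_continuous assms) auto
    then show ?thesis by blast
  qed
  then show ?thesis by (metis surjI)
qed

lemma degree_one_lift_uniformly_continuous:
  assumes "degree_one_lift G" "e > 0"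
  obtains d where "d > 0" "\<And>x y. \<bar>x - y\<bar> < d \<Longrightarrow> \<bar>G x - G y\<bar> < e"
proof -
  have "uniformly_continuous_on {-1..2} G"
    by (intro compact_uniformly_continuous degree_one_lift_continuous assms) auto
  then obtain d where d: "d > 0"
    "\<And>x y. x \<in> {-1..2} \<Longrightarrow> y \<in> {-1..2} \<Longrightarrow> dist y x < d \<Longrightarrow> dist (G y) (G x) < e"
    using assms(2) unfolding uniformly_continuous_on_def by metis
  have "\<bar>G x - G y\<bar> < e" if xy: "\<bar>x - y\<bar> < min d 1" for x y
  proof -
    define k where "k = - \<lfloor>x\<rfloor>"
    have fl: "of_int \<lfloor>x\<rfloor> \<le> x" "x < of_int \<lfloor>x\<rfloor> + 1" by linarith+
    then have "x + of_int k \<in> {-1..2}" "y + of_int k \<in> {-1..2}"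
      using xy unfolding k_def of_int_minus atLeastAtMost_iff by linarith+
    from d(2)[OF this(2,1)] have "\<bar>G (x + of_int k) - G (y + of_int k)\<bar> < e"
      using xy by (auto simp: dist_real_def)
    then show ?thesis
      using degree_one_lift_add_int[of G] assms(1) by (simp add: degree_one_lift_def)
  qed
  then show ?thesis using that[of "min d 1"] d(1) by auto
qed

lemma funpow_le_funpow:
  fixes F G :: "real \<Rightarrow> real"
  assumes "mono G" "\<And>x. G x \<le> F x"
  shows "(G ^^ n) x \<le> (F ^^ n) x"
proof (induction n)
  case (Suc n)
  then show ?case using monoD[OF assms(1) Suc] assms(2)[of "(F ^^ n) x"] by simp
qed simp

lemma funpow_ge_funpow:
  fixes F G :: "real \<Rightarrow> real"
  assumes "mono G" "\<And>x. F x \<le> G x"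
  shows "(F ^^ n) x \<le> (G ^^ n) x"
proof (induction n)
  case (Suc n)
  then show ?case using monoD[OF assms(1) Suc] assms(2)[of "(F ^^ n) x"] by simp
qed simp

lemma funpow_mult_displacement_ge:
  assumes "\<And>y. (G ^^ q) y \<ge> y + (s::real)"
  shows "(G ^^ (q * k)) x \<ge> x + real k * s"
proof (induction k)
  case (Suc k)
  have "(G ^^ (q * Suc k)) x = (G ^^ q) ((G ^^ (q * k)) x)"
    by (metis comp_apply funpow_add mult_Suc_right)
  then show ?case using Suc assms[of "(G ^^ (q * k)) x"] by (simp add: algebra_simps)
qed simp

text \<open>Since \<open>G\<close> moves points by a bounded amount, a lower bound on the drift of a single iterate \<open>G ^^ q\<close>
controls all iterates up to a constant: write \<open>n = r + q * k\<close> and absorb the \<open>r < q\<close> leftover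
steps into the constant.\<close>

lemma funpow_displacement_ge:
  assumes "degree_one_lift G" "q > 0" "\<And>y. (G ^^ q) y \<ge> y + real q * s"
  obtains C where "\<And>n x. (G ^^ n) x \<ge> x + real n * s - C"
proof -
  obtain M where M: "M \<ge> 0" "\<And>x. \<bar>G x - x\<bar> \<le> M"
    using degree_one_lift_displacement_bounded[OF assms(1)] by blast
  have "(G ^^ n) x \<ge> x + real n * s - (real q * \<bar>s\<bar> + real q * M)" for n x
  proof -
    define k r where "k = n div q" and "r = n mod q"
    have n: "n = r + q * k" by (simp add: k_def r_def)
    have r: "r < q" using assms(2) by (simp add: r_def)
    have "(G ^^ n) x = (G ^^ r) ((G ^^ (q * k)) x)" by (simp add: n funpow_add)
    moreover have "\<bar>(G ^^ r) ((G ^^ (q * k)) x) - (G ^^ (q * k)) x\<bar> \<le> real q * M"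
      using funpow_displacement_bounded[of G M r "(G ^^ (q * k)) x", OF M(2)] M(1) r
        mult_right_mono[of "real r" "real q" M] by linarith
    moreover have "(G ^^ (q * k)) x \<ge> x + real k * (real q * s)"
      by (rule funpow_mult_displacement_ge) (rule assms(3))
    moreover have "real n * s = real k * (real q * s) + real r * s"
      by (simp add: n algebra_simps)
    moreover have "real r * s \<le> real q * \<bar>s\<bar>"
      using mult_mono[of "real r" "real q" "\<bar>s\<bar>" "\<bar>s\<bar>"] mult_left_mono[OF abs_ge_self[of s], of "real r"] r
      by linarith
    ultimately show ?thesis by linarith
  qed
  then show ?thesis using that by blast
qed

text \<open>Conjugation by \<open>x \<mapsto> - x\<close> preserves liftings of degree one and reverses the order, so it turns
statements about suprema and lower bounds into those about infima and upper bounds.\<close>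

definition reflect :: "(real \<Rightarrow> real) \<Rightarrow> real \<Rightarrow> real" where
  "reflect G x = - G (- x)"

lemma funpow_reflect: "(reflect G ^^ n) x = - (G ^^ n) (- x)"
  by (induction n) (auto simp: reflect_def)

lemma degree_one_lift_reflect:
  assumes "degree_one_lift G"
  shows "degree_one_lift (reflect G)"
proof -
  have "continuous_on UNIV (reflect G)"
    unfolding reflect_def
    by (intro continuous_intros continuous_on_compose2[OF degree_one_lift_continuous[OF assms, of UNIV]]) auto
  moreover have "reflect G (x + 1) = reflect G x + 1" for x
    using degree_one_lift_add_int[of G "- x" "-1"] assms
    by (auto simp: reflect_def degree_one_lift_def)
  ultimately show ?thesis by (simp add: degree_one_lift_def)
qed

lemma funpow_displacement_le:
  assumes "degree_one_lift G" "q > 0" "\<And>y. (G ^^ q) y \<le> y + real q * s"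
  obtains C where "\<And>n x. (G ^^ n) x \<le> x + real n * s + C"
proof -
  have "(reflect G ^^ q) y \<ge> y + real q * (- s)" for y
    using assms(3)[of "- y"] by (simp add: funpow_reflect)
  then obtain C where C: "\<And>n x. (reflect G ^^ n) x \<ge> x + real n * (- s) - C"
    using funpow_displacement_ge[OF degree_one_lift_reflect[OF assms(1)] assms(2)] by blast
  have "(G ^^ n) x \<le> x + real n * s + C" for n x
    using C[where n = n and x = "- x"] by (simp add: funpow_reflect)
  then show ?thesis using that by blast
qed

lemma tendsto_const_plus_over_nat: "(\<lambda>n. ereal (s + c / real n)) \<longlonglongrightarrow> ereal s"
proof -
  have "(\<lambda>n. s + c / real n) \<longlonglongrightarrow> s + 0"
    by (intro tendsto_intros lim_const_over_n)
  then show ?thesis by simp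
qed

text \<open>The quotients are bounded by the maximal displacement of \<open>F\<close>, so their upper limit is finite and
no information is lost in the definition of the rotation number.\<close>

lemma rotation_number_limsup:
  assumes "degree_one_lift F"
  shows "limsup (\<lambda>n. ereal (((F ^^ n) x - x) / real n)) = ereal (rotation_number F x)"
proof -
  obtain M where M: "M \<ge> 0" "\<And>x. \<bar>F x - x\<bar> \<le> M"
    using degree_one_lift_displacement_bounded[OF assms] by blast
  have b: "\<bar>((F ^^ n) x - x) / real n\<bar> \<le> M" for n
    using funpow_displacement_bounded[of F M n x, OF M(2)] M(1)
    by (cases "n = 0") (auto simp: field_simps abs_if split: if_splits)
  have b: "((F ^^ n) x - x) / real n \<le> M" "- M \<le> ((F ^^ n) x - x) / real n" for n
    using b[of n] by (simp_all only: abs_le_iff, linarith+)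
  have "limsup (\<lambda>n. ereal (((F ^^ n) x - x) / real n)) \<le> ereal M"
    using b(1) by (intro Limsup_bounded always_eventually) auto
  moreover have "ereal (- M) \<le> limsup (\<lambda>n. ereal (((F ^^ n) x - x) / real n))"
  proof (rule order_trans[OF _ Liminf_le_Limsup])
    show "ereal (- M) \<le> liminf (\<lambda>n. ereal (((F ^^ n) x - x) / real n))"
      using b(2) by (intro Liminf_bounded always_eventually) auto
  qed simp
  ultimately show ?thesis
    unfolding rotation_number_def
    by (cases "limsup (\<lambda>n. ereal (((F ^^ n) x - x) / real n))") auto
qed

lemma rotation_number_ge:
  assumes "degree_one_lift F" "\<And>n. (F ^^ n) x \<ge> x + real n * s - C"
  shows "rotation_number F x \<ge> s"
proof -
  have "ereal s = limsup (\<lambda>n. ereal (s + (- C) / real n))"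
    using lim_imp_Limsup[OF _ tendsto_const_plus_over_nat[of s "- C"]] by simp
  also have "\<dots> \<le> limsup (\<lambda>n. ereal (((F ^^ n) x - x) / real n))"
  proof (intro Limsup_mono eventually_sequentiallyI[of 1])
    fix n :: nat assume "1 \<le> n"
    then have "s + (- C) / real n = (real n * s - C) / real n"
      by (simp add: diff_divide_distrib)
    also have "\<dots> \<le> ((F ^^ n) x - x) / real n"
      using assms(2)[of n] by (intro divide_right_mono) auto
    finally show "ereal (s + (- C) / real n) \<le> ereal (((F ^^ n) x - x) / real n)" by simp
  qed
  finally show ?thesis by (simp add: rotation_number_limsup[OF assms(1)])
qed

lemma rotation_number_le:
  assumes "degree_one_lift F" "\<And>n. (F ^^ n) x \<le> x + real n * s + C"
  shows "rotation_number F x \<le> s"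
proof -
  have "limsup (\<lambda>n. ereal (((F ^^ n) x - x) / real n)) \<le> limsup (\<lambda>n. ereal (s + C / real n))"
  proof (intro Limsup_mono eventually_sequentiallyI[of 1])
    fix n :: nat assume "1 \<le> n"
    have "((F ^^ n) x - x) / real n \<le> (real n * s + C) / real n"
      using assms(2)[of n] by (intro divide_right_mono) auto
    also have "\<dots> = s + C / real n"
      using \<open>1 \<le> n\<close> by (simp add: add_divide_distrib)
    finally show "ereal (((F ^^ n) x - x) / real n) \<le> ereal (s + C / real n)" by simp
  qed
  also have "\<dots> = ereal s"
    using lim_imp_Limsup[OF _ tendsto_const_plus_over_nat[of s C]] by simp
  finally show ?thesis by (simp add: rotation_number_limsup[OF assms(1)])
qed


section \<open>Monotone truncations of a lifting\<close>

definition running_sup :: "(real \<Rightarrow> real) \<Rightarrow> real \<Rightarrow> real" where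
  "running_sup g x = (SUP y\<in>{..x}. g y)"

definition running_inf :: "(real \<Rightarrow> real) \<Rightarrow> real \<Rightarrow> real" where
  "running_inf g = reflect (running_sup (reflect g))"

lemma bdd_above_running:
  assumes "degree_one_lift g"
  shows "bdd_above (g ` {..x})"
proof -
  obtain M where M: "\<And>x. \<bar>g x - x\<bar> \<le> M"
    using degree_one_lift_displacement_bounded[OF assms] by blast
  have "g y \<le> x + M" if "y \<le> x" for y using M[of y] that by linarith
  then show ?thesis by (auto intro!: bdd_aboveI[of _ "x + M"])
qed

lemma le_running_sup:
  assumes "degree_one_lift g" "y \<le> x"
  shows "g y \<le> running_sup g x"
  unfolding running_sup_def using assms by (intro cSUP_upper bdd_above_running) auto

lemma running_sup_le:
  assumes "\<And>y. y \<le> x \<Longrightarrow> g y \<le> c"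
  shows "running_sup g x \<le> c"
  unfolding running_sup_def using assms by (intro cSUP_least) auto

lemma running_sup_mono:
  assumes "degree_one_lift g"
  shows "mono (running_sup g)"
  by (intro monoI running_sup_le) (meson assms le_running_sup order_trans)

text \<open>Shifting the argument amounts to translating the function. Together with the next lemma this reduces
periodicity and continuity of the running supremum to those of \<open>g\<close>: a translate of \<open>g\<close> by a small
amount is uniformly close to \<open>g\<close>.\<close>

lemma running_sup_shift:
  "running_sup g (x + s) = running_sup (\<lambda>y. g (y + s)) x"
proof -
  have "{..x + s} = (\<lambda>y. y + s) ` {..x}"
    using image_add_atMost[of s x] by (simp add: add.commute)
  then show ?thesis by (simp add: running_sup_def image_image)
qed

lemma running_sup_perturb:
  assumes "degree_one_lift g'" "\<And>y. g y \<le> g' y + e"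
  shows "running_sup g x \<le> running_sup g' x + e"
proof (rule running_sup_le)
  fix y assume "y \<le> x"
  then show "g y \<le> running_sup g' x + e"
    using le_running_sup[OF assms(1), of y x] assms(2)[of y] by linarith
qed

lemma degree_one_lift_translate:
  assumes "degree_one_lift g"
  shows "degree_one_lift (\<lambda>y. g (y + s))"
proof -
  have "continuous_on UNIV (\<lambda>y. g (y + s))"
    by (rule continuous_on_compose2[OF degree_one_lift_continuous[OF assms, of UNIV]])
      (auto intro: continuous_intros)
  moreover have "g (x + 1 + s) = g (x + s) + 1" for x
    using degree_one_lift_add_1[OF assms, of "x + s"] by (simp add: algebra_simps)
  ultimately show ?thesis by (simp add: degree_one_lift_def)
qed

lemma degree_one_lift_running_sup:
  assumes "degree_one_lift g"
  shows "degree_one_lift (running_sup g)"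
proof -
  have sh: "running_sup g (x + 1) = running_sup g x + 1" for x
  proof -
    have "running_sup g (x + 1) = running_sup (\<lambda>y. g y + 1) x"
      by (simp add: running_sup_shift degree_one_lift_add_1[OF assms])
    also have "\<dots> = running_sup g x + 1"
    proof (rule antisym)
      show "running_sup (\<lambda>y. g y + 1) x \<le> running_sup g x + 1"
        by (rule running_sup_perturb[OF assms]) simp
      have "running_sup g x \<le> running_sup (\<lambda>y. g (y + 1)) x + (- 1)"
        by (rule running_sup_perturb)
          (rule degree_one_lift_translate[OF assms], simp add: degree_one_lift_add_1[OF assms])
      then show "running_sup g x + 1 \<le> running_sup (\<lambda>y. g y + 1) x"
        by (simp add: degree_one_lift_add_1[OF assms])
    qed
    finally show ?thesis .
  qed
  have "continuous_on UNIV (running_sup g)"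
  proof (unfold continuous_on_iff, intro ballI allI impI)
    fix x e :: real assume "e > 0"
    then obtain d where d: "d > 0" "\<And>x y. \<bar>x - y\<bar> < d \<Longrightarrow> \<bar>g x - g y\<bar> < e / 2"
      using degree_one_lift_uniformly_continuous[OF assms, of "e / 2"] by auto
    have "dist (running_sup g x') (running_sup g x) < e" if "dist x' x < d" for x'
    proof -
      let ?h = "\<lambda>y. g (y + (x' - x))"
      have near: "\<bar>?h y - g y\<bar> < e / 2" for y
        using d(2)[of "y + (x' - x)" y] that by (simp add: dist_real_def)
      have "running_sup ?h x \<le> running_sup g x + e / 2"
      proof (rule running_sup_perturb[OF assms])
        show "?h y \<le> g y + e / 2" for y using near[of y] by linarith
      qed
      moreover have "running_sup g x \<le> running_sup ?h x + e / 2"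
      proof (rule running_sup_perturb[OF degree_one_lift_translate[OF assms]])
        show "g y \<le> ?h y + e / 2" for y using near[of y] by linarith
      qed
      ultimately show ?thesis
        using running_sup_shift[of g x "x' - x"] \<open>e > 0\<close> by (simp add: dist_real_def)
    qed
    then show "\<exists>d>0. \<forall>x'\<in>UNIV. dist x' x < d \<longrightarrow> dist (running_sup g x') (running_sup g x) < e"
      using d(1) by blast
  qed
  with sh show ?thesis by (simp add: degree_one_lift_def)
qed

text \<open>Over the points beyond \<open>y\<close> only the values above the old supremum matter; this is the one-sided
estimate from which both constancy lemmas below follow.\<close>

lemma running_sup_le_max:
  assumes "degree_one_lift g" "\<And>w. y < w \<Longrightarrow> w \<le> z \<Longrightarrow> g w \<le> v"
  shows "running_sup g z \<le> max (running_sup g y) v"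
proof (rule running_sup_le)
  fix w assume "w \<le> z"
  then show "g w \<le> max (running_sup g y) v"
    using le_running_sup[OF assms(1), of w y] assms(2)[of w] by (cases "w \<le> y") auto
qed

definition locally_constant_at :: "(real \<Rightarrow> real) \<Rightarrow> real \<Rightarrow> bool" where
  "locally_constant_at G x \<longleftrightarrow> (\<exists>e>0. \<forall>y. \<bar>y - x\<bar> < e \<longrightarrow> G y = G x)"

text \<open>Where the supremum exceeds the current value it is attained strictly to the left, and by continuity
it stays the supremum on a whole neighbourhood.\<close>

lemma running_sup_locally_constant:
  assumes "degree_one_lift g" "running_sup g x \<noteq> g x"
  shows "locally_constant_at (running_sup g) x"
proof -
  have less: "g x < running_sup g x"
    using le_running_sup[OF assms(1), of x x] assms(2) by simp
  define v where "v = (g x + running_sup g x) / 2"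
  have "v - g x > 0" using less by (simp add: v_def)
  obtain e where e: "e > 0" "\<And>y. \<bar>y - x\<bar> < e \<Longrightarrow> \<bar>g y - g x\<bar> < v - g x"
    using degree_one_lift_uniformly_continuous[OF assms(1) \<open>v - g x > 0\<close>] by metis
  have v: "g w \<le> v" if "\<bar>w - x\<bar> < e" for w
    using e(2)[OF that] by linarith
  have "running_sup g y = running_sup g x" if y: "\<bar>y - x\<bar> < e" for y
  proof (cases "y \<le> x")
    case True
    have "running_sup g x \<le> max (running_sup g y) v"
      using y by (intro running_sup_le_max[OF assms(1)] v) auto
    then have "running_sup g x \<le> running_sup g y"
      using less by (auto simp: v_def max_def split: if_splits)
    then show ?thesis using monoD[OF running_sup_mono[OF assms(1)] True] by simp
  next
    case False
    have "running_sup g y \<le> max (running_sup g x) v"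
      using y False by (intro running_sup_le_max[OF assms(1)] v) auto
    then have "running_sup g y \<le> running_sup g x"
      using less by (auto simp: v_def max_def split: if_splits)
    then show ?thesis using monoD[OF running_sup_mono[OF assms(1)], of x y] False by simp
  qed
  then show ?thesis using e(1) unfolding locally_constant_at_def by blast
qed

lemma degree_one_lift_running_inf:
  assumes "degree_one_lift g"
  shows "degree_one_lift (running_inf g)"
  unfolding running_inf_def
  by (intro degree_one_lift_reflect degree_one_lift_running_sup assms)

lemma running_inf_le:
  assumes "degree_one_lift g" "x \<le> y"
  shows "running_inf g x \<le> g y"
  using le_running_sup[OF degree_one_lift_reflect[OF assms(1)], of "- y" "- x"] assms(2)
  by (simp add: running_inf_def reflect_def)

lemma running_inf_ge:
  assumes "\<And>y. x \<le> y \<Longrightarrow> c \<le> g y"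
  shows "c \<le> running_inf g x"
proof -
  have "running_sup (reflect g) (- x) \<le> - c"
    using assms by (intro running_sup_le) (auto simp: reflect_def)
  then show ?thesis by (simp add: running_inf_def reflect_def[of "running_sup (reflect g)"])
qed

lemma running_inf_locally_constant:
  assumes "degree_one_lift g" "running_inf g x \<noteq> g x"
  shows "locally_constant_at (running_inf g) x"
proof -
  have "running_sup (reflect g) (- x) \<noteq> reflect g (- x)"
    using assms(2) by (auto simp: running_inf_def reflect_def)
  from running_sup_locally_constant[OF degree_one_lift_reflect[OF assms(1)] this]
  obtain e where e: "e > 0"
    "\<And>y. \<bar>y - - x\<bar> < e \<Longrightarrow> running_sup (reflect g) y = running_sup (reflect g) (- x)"
    unfolding locally_constant_at_def by blast
  have "running_inf g y = running_inf g x" if "\<bar>y - x\<bar> < e" for y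
    using e(2)[of "- y"] that unfolding running_inf_def reflect_def[of "running_sup (reflect g)"]
    by (simp add: abs_minus_commute)
  then show ?thesis using e(1) unfolding locally_constant_at_def by blast
qed

text \<open>The truncations form a monotone family of nondecreasing maps leading from the largest nondecreasing
map below \<open>F\<close> (at \<open>t = 0\<close>) to the smallest one above it (at large \<open>t\<close>). The cap is a raised copy of
the running infimum, so that where it is active the infimum lies strictly below \<open>F\<close> and is locally
constant.\<close>

definition truncation :: "(real \<Rightarrow> real) \<Rightarrow> real \<Rightarrow> real \<Rightarrow> real" where
  "truncation F t = running_sup (\<lambda>y. min (F y) (running_inf F y + t))"

context
  fixes F :: "real \<Rightarrow> real"
  assumes F: "degree_one_lift F"
begin

lemma degree_one_lift_capped:
  "degree_one_lift (\<lambda>y. min (F y) (running_inf F y + t))"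
proof -
  have "continuous_on UNIV (\<lambda>y. min (F y) (running_inf F y + t))"
    by (intro continuous_intros degree_one_lift_continuous degree_one_lift_running_inf F)
  then show ?thesis
    using degree_one_lift_add_1[OF F] degree_one_lift_add_1[OF degree_one_lift_running_inf[OF F]]
    by (auto simp: degree_one_lift_def min_def)
qed

lemma degree_one_lift_truncation: "degree_one_lift (truncation F t)"
  unfolding truncation_def by (intro degree_one_lift_running_sup degree_one_lift_capped)

lemma truncation_mono: "mono (truncation F t)"
  unfolding truncation_def by (intro running_sup_mono degree_one_lift_capped)

text \<open>There are two ways to differ from \<open>F\<close>. If the running supremum exceeds the capped map, it is locally
constant by the general principle. If it equals the capped map, then the cap must be active, so the
running infimum lies strictly below \<open>F\<close>; hence it is locally constant, so is the capped map, and so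
is its running supremum.\<close>

lemma truncation_locally_constant:
  assumes "t \<ge> 0" "truncation F t x \<noteq> F x"
  shows "locally_constant_at (truncation F t) x"
proof -
  let ?g = "\<lambda>y. min (F y) (running_inf F y + t)"
  note g = degree_one_lift_capped[of t]
  show ?thesis
  proof (cases "truncation F t x = ?g x")
    case False
    then show ?thesis
      unfolding truncation_def by (intro running_sup_locally_constant[OF g]) auto
  next
    case True
    with assms(2) have less: "running_inf F x + t < F x"
      by (auto simp: min_def split: if_splits)
    with assms(1) have "running_inf F x \<noteq> F x" by simp
    from running_inf_locally_constant[OF F this] obtain e1 where e1:
      "e1 > 0" "\<And>y. \<bar>y - x\<bar> < e1 \<Longrightarrow> running_inf F y = running_inf F x"
      unfolding locally_constant_at_def by blast
    obtain e2 where e2: "e2 > 0"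
      "\<And>y. \<bar>y - x\<bar> < e2 \<Longrightarrow> \<bar>F y - F x\<bar> < F x - (running_inf F x + t)"
      using degree_one_lift_uniformly_continuous[OF F, of "F x - (running_inf F x + t)"] less
      by (metis diff_gt_0_iff_gt)
    have gc: "?g y = ?g x" if "\<bar>y - x\<bar> < min e1 e2" for y
      using e1(2)[of y] e2(2)[of y] that less by (auto simp: min_def abs_if split: if_splits)
    have gx: "running_sup ?g x = ?g x" using True by (simp add: truncation_def)
    have "running_sup ?g y = running_sup ?g x" if y: "\<bar>y - x\<bar> < min e1 e2" for y
    proof (cases "y \<le> x")
      case True
      have "?g x \<le> running_sup ?g y"
        using le_running_sup[OF g, of y y] unfolding gc[OF y] by simp
      then show ?thesis using gx monoD[OF running_sup_mono[OF g] True] by linarith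
    next
      case False
      have "running_sup ?g y \<le> max (running_sup ?g x) (?g x)"
      proof (rule running_sup_le_max[OF g])
        fix w assume "x < w" "w \<le> y"
        then show "?g w \<le> ?g x" using gc[of w] y by simp
      qed
      then show ?thesis using gx monoD[OF running_sup_mono[OF g], of x y] False by linarith
    qed
    then show ?thesis
      unfolding truncation_def locally_constant_at_def using e1(1) e2(1)
      by (metis min_less_iff_conj)
  qed
qed

lemma truncation_0_le: "truncation F 0 x \<le> F x"
  unfolding truncation_def
proof (rule running_sup_le)
  fix y assume "y \<le> x"
  then show "min (F y) (running_inf F y + 0) \<le> F x"
    using running_inf_le[OF F, of y x] by simp
qed

lemma truncation_ge_eventually:
  obtains t where "t \<ge> 0" "\<And>x. F x \<le> truncation F t x"
proof -
  obtain M where M: "M \<ge> 0" "\<And>x. \<bar>F x - x\<bar> \<le> M"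
    using degree_one_lift_displacement_bounded[OF F] by blast
  have "F x \<le> truncation F (2 * M) x" for x
  proof -
    have "x - M \<le> running_inf F x"
    proof (rule running_inf_ge)
      fix y assume "x \<le> y"
      then show "x - M \<le> F y" using M(2)[of y] by linarith
    qed
    then have "F x \<le> running_inf F x + 2 * M" using M(2)[of x] by linarith
    then show ?thesis
      using le_running_sup[OF degree_one_lift_capped[of "2 * M"], of x x]
      by (simp add: truncation_def)
  qed
  then show ?thesis using that[of "2 * M"] M(1) by simp
qed

lemma truncation_lipschitz: "\<bar>truncation F t x - truncation F s x\<bar> \<le> \<bar>t - s\<bar>"
proof -
  have le: "truncation F a x \<le> truncation F b x + \<bar>a - b\<bar>" for a b
    unfolding truncation_def
    by (rule running_sup_perturb[OF degree_one_lift_capped]) (auto simp: min_def abs_if)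
  show ?thesis using le[of t s] le[of s t] by (simp add: abs_le_iff abs_minus_commute)
qed

lemma truncation_jointly_continuous:
  "continuous_on UNIV (\<lambda>z. truncation F (fst z) (snd z))"
proof -
  have "isCont (\<lambda>z. truncation F (fst z) (snd z)) w" for w
  proof -
    have c: "isCont (truncation F (fst w)) (snd w)"
      using degree_one_lift_continuous[OF degree_one_lift_truncation, of UNIV]
      by (simp add: continuous_on_eq_continuous_at)
    have "((\<lambda>z. truncation F (fst z) (snd z) - truncation F (fst w) (snd z)) \<longlongrightarrow> 0) (at w)"
    proof (rule Lim_null_comparison)
      show "\<forall>\<^sub>F z in at w. norm (truncation F (fst z) (snd z) - truncation F (fst w) (snd z))
          \<le> \<bar>fst z - fst w\<bar>"
        by (simp add: truncation_lipschitz)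
      show "((\<lambda>z. \<bar>fst z - fst w\<bar>) \<longlongrightarrow> 0) (at w)"
        by (intro tendsto_eq_intros) auto
    qed
    moreover have "((\<lambda>z. truncation F (fst w) (snd z)) \<longlongrightarrow> truncation F (fst w) (snd w)) (at w)"
      by (intro isCont_tendsto_compose[OF c] tendsto_intros)
    ultimately show ?thesis
      unfolding isCont_def using tendsto_add by fastforce
  qed
  then show ?thesis by (simp add: continuous_at_imp_continuous_on)
qed

text \<open>Joint continuity in the parameter and the point is what makes the two drift conditions below open in
the parameter.\<close>

lemma truncation_funpow_jointly_continuous:
  "continuous_on UNIV (\<lambda>z. (truncation F (fst z) ^^ n) (snd z))"
proof (induction n)
  case (Suc n)
  have "continuous_on UNIV (\<lambda>z. (\<lambda>w. truncation F (fst w) (snd w))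
      (fst z, (truncation F (fst z) ^^ n) (snd z)))"
    by (rule continuous_on_compose2[OF truncation_jointly_continuous])
      (auto intro!: continuous_intros Suc)
  then show ?case by simp
qed (simp add: continuous_on_snd)

end

section \<open>Choosing the truncation with a given rotation number\<close>

text \<open>For a nondecreasing lifting of degree one, \<open>drift_below \<rho>\<close> and \<open>drift_above \<rho>\<close> say that its rotation
number is smaller, respectively larger, than \<open>\<rho>\<close>; they are phrased through a single iterate so that
they are visibly open conditions.\<close>

definition drift_below :: "real \<Rightarrow> (real \<Rightarrow> real) \<Rightarrow> bool" where
  "drift_below \<rho> G \<longleftrightarrow> (\<exists>n\<ge>1. \<forall>x. (G ^^ n) x < x + real n * \<rho>)"

definition drift_above :: "real \<Rightarrow> (real \<Rightarrow> real) \<Rightarrow> bool" where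
  "drift_above \<rho> G \<longleftrightarrow> (\<exists>n\<ge>1. \<forall>x. (G ^^ n) x > x + real n * \<rho>)"

lemma funpow_mult_drift_above:
  assumes "\<And>y. (G ^^ q) y > y + (s::real)" "k > 0"
  shows "(G ^^ (q * k)) x > x + real k * s"
  using assms(2)
proof (induction k rule: nat_induct_non_zero)
  case (Suc k)
  have "(G ^^ (q * Suc k)) x = (G ^^ q) ((G ^^ (q * k)) x)"
    by (metis comp_apply funpow_add mult_Suc_right)
  then show ?case using Suc assms(1)[of "(G ^^ (q * k)) x"] by (simp add: algebra_simps)
qed (simp add: assms)

lemma funpow_mult_drift_below:
  assumes "\<And>y. (G ^^ q) y < y + (s::real)" "k > 0"
  shows "(G ^^ (q * k)) x < x + real k * s"
  using assms(2)
proof (induction k rule: nat_induct_non_zero)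
  case (Suc k)
  have "(G ^^ (q * Suc k)) x = (G ^^ q) ((G ^^ (q * k)) x)"
    by (metis comp_apply funpow_add mult_Suc_right)
  then show ?case using Suc assms(1)[of "(G ^^ (q * k)) x"] by (simp add: algebra_simps)
qed (simp add: assms)

text \<open>If \<open>G ^^ m\<close> witnesses the first and \<open>G ^^ n\<close> the second condition, then \<open>G ^^ (m * n)\<close> satisfies both
strict inequalities.\<close>

lemma not_drift_above_and_below:
  assumes "drift_below \<rho> G" "drift_above \<rho> G"
  shows False
proof -
  obtain m n where mn: "m \<ge> 1" "\<And>x. (G ^^ m) x < x + real m * \<rho>"
    "n \<ge> 1" "\<And>x. (G ^^ n) x > x + real n * \<rho>"
    using assms unfolding drift_below_def drift_above_def by blast
  show False
    using funpow_mult_drift_below[where q = m and k = n and G = G and s = "real m * \<rho>" and x = 0]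
      funpow_mult_drift_above[where q = n and k = m and G = G and s = "real n * \<rho>" and x = 0] mn
    by (simp add: mult.commute mult.left_commute)
qed

text \<open>If neither condition holds at time \<open>n\<close>, then some point moves by at least \<open>n * \<rho>\<close> and
some point by at most that. By monotonicity and periodicity any two displacements of the same iterate differ by at
most one, because every \<open>y\<close> lies within distance one of integer translates of both points, on either
side.\<close>

lemma bounded_deviation:
  assumes G: "degree_one_lift G" "mono G"
    and not: "\<not> drift_below \<rho> G" "\<not> drift_above \<rho> G"
  shows "\<bar>(G ^^ n) y - y - real n * \<rho>\<bar> \<le> 1"
proof (cases "n \<ge> 1")
  case True
  let ?h = "G ^^ n"
  have h: "?h (x + of_int k) = ?h x + of_int k" for x k
    using degree_one_lift_add_int degree_one_lift_add_1[OF degree_one_lift_funpow[OF G(1)]] by blast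
  have mono: "x \<le> z \<Longrightarrow> ?h x \<le> ?h z" for x z
    using funpow_mono[OF G(2)] by simp
  obtain a where a: "?h a \<ge> a + real n * \<rho>"
    using not(1) True unfolding drift_below_def by (meson not_le)
  obtain b where b: "?h b \<le> b + real n * \<rho>"
    using not(2) True unfolding drift_above_def by (meson not_le)
  have "?h (a + of_int \<lfloor>y - a\<rfloor>) \<le> ?h y"
    by (rule mono) linarith
  then have 1: "?h y \<ge> y - 1 + real n * \<rho>"
    using a h[of a "\<lfloor>y - a\<rfloor>"] by linarith
  have "?h y \<le> ?h (b + of_int \<lceil>y - b\<rceil>)"
    by (rule mono) linarith
  then have 2: "?h y \<le> y + 1 + real n * \<rho>"
    using b h[of b "\<lceil>y - b\<rceil>"] by linarith
  from 1 2 show ?thesis by (simp add: abs_le_iff)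
next
  case False
  then have "n = 0" by simp
  then show ?thesis by simp
qed

text \<open>The displacement of an iterate is periodic, so it suffices to quantify over the compact unit interval;
the parameters violating the inequality form the projection of a closed set along it.\<close>

lemma open_drift_truncation:
  assumes F: "degree_one_lift F"
  shows "open {t. drift_below \<rho> (truncation F t)}" "open {t. drift_above \<rho> (truncation F t)}"
proof -
  let ?\<Phi> = "\<lambda>n t x. (truncation F t ^^ n) x"
  have red: "?\<Phi> n t x - x = ?\<Phi> n t (frac x) - frac x" for n t x
    using degree_one_lift_frac
      degree_one_lift_add_1[OF degree_one_lift_funpow[OF degree_one_lift_truncation[OF F]]] by blast
  have fr: "frac x \<in> {0..1}" for x :: real using frac_lt_1[of x] by simp
  have joint: "continuous_on UNIV (\<lambda>z::real \<times> real. ?\<Phi> n (snd z) (fst z))" for n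
  proof -
    have "continuous_on UNIV (\<lambda>z::real \<times> real. (snd z, fst z))"
      by (intro continuous_on_Pair continuous_on_snd continuous_on_fst continuous_on_id)
    then show ?thesis
      using continuous_on_compose2[OF truncation_funpow_jointly_continuous[OF F, of n],
          of UNIV "\<lambda>z. (snd z, fst z)"] by simp
  qed
  have "{t. \<exists>x. x + real n * \<rho> \<le> ?\<Phi> n t x}
      = {t. \<exists>x. x \<in> {0..1} \<and> (x, t) \<in> {z. fst z + real n * \<rho> \<le> ?\<Phi> n (snd z) (fst z)}}" for n
  proof (intro Collect_cong iffI; elim exE)
    fix t x assume "x + real n * \<rho> \<le> ?\<Phi> n t x"
    then have "frac x + real n * \<rho> \<le> ?\<Phi> n t (frac x)" using red[of n t x] by linarith
    then show "\<exists>x. x \<in> {0..1} \<and> (x, t) \<in> {z. fst z + real n * \<rho> \<le> ?\<Phi> n (snd z) (fst z)}"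
      using fr[of x] by (intro exI[of _ "frac x"]) auto
  qed auto
  then have "closed {t. \<exists>x. x + real n * \<rho> \<le> ?\<Phi> n t x}" for n
    by (simp only:) (intro closed_compact_projection closed_Collect_le joint continuous_intros; simp)
  then have "open (\<Union>n\<in>{1..}. - {t. \<exists>x. x + real n * \<rho> \<le> ?\<Phi> n t x})"
    by (intro open_UN ballI open_Compl)
  also have "(\<Union>n\<in>{1..}. - {t. \<exists>x. x + real n * \<rho> \<le> ?\<Phi> n t x}) = {t. drift_below \<rho> (truncation F t)}"
    by (auto simp: drift_below_def not_le Bex_def)
  finally show "open {t. drift_below \<rho> (truncation F t)}" .
  have "{t. \<exists>x. ?\<Phi> n t x \<le> x + real n * \<rho>}
      = {t. \<exists>x. x \<in> {0..1} \<and> (x, t) \<in> {z. ?\<Phi> n (snd z) (fst z) \<le> fst z + real n * \<rho>}}" for n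
  proof (intro Collect_cong iffI; elim exE)
    fix t x assume "?\<Phi> n t x \<le> x + real n * \<rho>"
    then have "?\<Phi> n t (frac x) \<le> frac x + real n * \<rho>" using red[of n t x] by linarith
    then show "\<exists>x. x \<in> {0..1} \<and> (x, t) \<in> {z. ?\<Phi> n (snd z) (fst z) \<le> fst z + real n * \<rho>}"
      using fr[of x] by (intro exI[of _ "frac x"]) auto
  qed auto
  then have "closed {t. \<exists>x. ?\<Phi> n t x \<le> x + real n * \<rho>}" for n
    by (simp only:) (intro closed_compact_projection closed_Collect_le joint continuous_intros; simp)
  then have "open (\<Union>n\<in>{1..}. - {t. \<exists>x. ?\<Phi> n t x \<le> x + real n * \<rho>})"
    by (intro open_UN ballI open_Compl)
  also have "(\<Union>n\<in>{1..}. - {t. \<exists>x. ?\<Phi> n t x \<le> x + real n * \<rho>}) = {t. drift_above \<rho> (truncation F t)}"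
    by (auto simp: drift_above_def not_le Bex_def)
  finally show "open {t. drift_above \<rho> (truncation F t)}" .
qed

text \<open>By compactness the strict drift of \<open>G\<close> is uniform, hence has some speed \<open>s > \<rho>\<close>. Orbits of \<open>F\<close> stay
ahead of those of the nondecreasing map \<open>G\<close> below it, so all of them have speed at least \<open>s\<close>.\<close>

lemma drift_above_imp_rotation_number_gt:
  assumes F: "degree_one_lift F" and G: "degree_one_lift G" "mono G" "\<And>x. G x \<le> F x"
    and d: "drift_above \<rho> G"
  shows "rotation_number F x > \<rho>"
proof -
  obtain n where n: "n \<ge> 1" "\<And>x. (G ^^ n) x > x + real n * \<rho>"
    using d unfolding drift_above_def by blast
  obtain a where a: "\<And>x. (G ^^ n) a - a \<le> (G ^^ n) x - x"
    using degree_one_lift_displacement_extrema[OF degree_one_lift_funpow[OF G(1)]] by blast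
  define s where "s = ((G ^^ n) a - a) / real n"
  have s: "s > \<rho>" using n(2)[of a] n(1) by (simp add: s_def field_simps)
  have "(G ^^ n) y \<ge> y + real n * s" for y
    using a[of y] n(1) by (simp add: s_def)
  then obtain C where C: "\<And>k x. (G ^^ k) x \<ge> x + real k * s - C"
    using funpow_displacement_ge[OF G(1), of n s] n(1) by auto
  have "rotation_number F x \<ge> s"
    using order_trans[OF C funpow_le_funpow[OF G(2,3)]] by (intro rotation_number_ge[OF F])
  with s show ?thesis by simp
qed

lemma drift_below_imp_rotation_number_lt:
  assumes F: "degree_one_lift F" and G: "degree_one_lift G" "mono G" "\<And>x. F x \<le> G x"
    and d: "drift_below \<rho> G"
  shows "rotation_number F x < \<rho>"
proof -
  obtain n where n: "n \<ge> 1" "\<And>x. (G ^^ n) x < x + real n * \<rho>"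
    using d unfolding drift_below_def by blast
  obtain a where a: "\<And>x. (G ^^ n) x - x \<le> (G ^^ n) a - a"
    using degree_one_lift_displacement_extrema[OF degree_one_lift_funpow[OF G(1)]] by blast
  define s where "s = ((G ^^ n) a - a) / real n"
  have s: "s < \<rho>" using n(2)[of a] n(1) by (simp add: s_def field_simps)
  have "(G ^^ n) y \<le> y + real n * s" for y
    using a[of y] n(1) by (simp add: s_def)
  then obtain C where C: "\<And>k x. (G ^^ k) x \<le> x + real k * s + C"
    using funpow_displacement_le[OF G(1), of n s] n(1) by auto
  have "rotation_number F x \<le> s"
    using order_trans[OF funpow_ge_funpow[OF G(2,3)] C] by (intro rotation_number_le[OF F])
  with s show ?thesis by simp
qed

text \<open>The lowest truncation does not drift above \<open>\<rho>\<close> and the highest does not drift below \<open>\<rho>\<close>, because \<open>F\<close>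
has points that rotate at most, respectively at least, as fast as \<open>\<rho>\<close>. The two open conditions are
disjoint, so by connectedness they cannot cover the parameter interval.\<close>

theorem monotone_truncation_with_rotation_number:
  assumes F: "degree_one_lift F"
    and \<rho>: "\<rho>1 \<in> rotation_set F" "\<rho>2 \<in> rotation_set F" "\<rho>1 \<le> \<rho>" "\<rho> \<le> \<rho>2"
  obtains G where "degree_one_lift G" "mono G"
    "\<And>x. G x \<noteq> F x \<Longrightarrow> locally_constant_at G x"
    "\<And>n x. \<bar>(G ^^ n) x - x - real n * \<rho>\<bar> \<le> 1"
proof -
  let ?G = "truncation F"
  obtain x1 x2 where x: "rotation_number F x1 \<le> \<rho>" "\<rho> \<le> rotation_number F x2"
    using \<rho> unfolding rotation_set_def by auto
  obtain T where T: "T \<ge> 0" "\<And>x. F x \<le> ?G T x"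
    using truncation_ge_eventually[OF F] by blast
  have 0: "\<not> drift_above \<rho> (?G 0)"
    using drift_above_imp_rotation_number_gt[OF F degree_one_lift_truncation[OF F]
        truncation_mono[OF F] truncation_0_le[OF F], of \<rho> x1] x(1) by auto
  have T': "\<not> drift_below \<rho> (?G T)"
    using drift_below_imp_rotation_number_lt[OF F degree_one_lift_truncation[OF F]
        truncation_mono[OF F] T(2), of \<rho> x2] x(2) by auto
  have "\<exists>t\<in>{0..T}. \<not> drift_below \<rho> (?G t) \<and> \<not> drift_above \<rho> (?G t)"
  proof (rule ccontr)
    assume "\<not> ?thesis"
    then have cover: "{0..T} \<subseteq> {t. drift_below \<rho> (?G t)} \<union> {t. drift_above \<rho> (?G t)}" by blast
    have "{t. drift_below \<rho> (?G t)} \<inter> {0..T} = {} \<or> {t. drift_above \<rho> (?G t)} \<inter> {0..T} = {}"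
      using not_drift_above_and_below
      by (intro connectedD[OF _ open_drift_truncation[OF F] _ cover]) auto
    moreover have "0 \<in> {0..T}" "T \<in> {0..T}" using T(1) by auto
    ultimately show False using cover 0 T' by blast
  qed
  then obtain t where t: "t \<ge> 0" "\<not> drift_below \<rho> (?G t)" "\<not> drift_above \<rho> (?G t)" by auto
  show ?thesis
  proof (rule that[of "?G t"])
    show "degree_one_lift (?G t)" by (rule degree_one_lift_truncation[OF F])
    show "mono (?G t)" by (rule truncation_mono[OF F])
    show "locally_constant_at (?G t) x" if "?G t x \<noteq> F x" for x
      by (rule truncation_locally_constant[OF F t(1) that])
    show "\<bar>(?G t ^^ n) x - x - real n * \<rho>\<bar> \<le> 1" for n x
      by (rule bounded_deviation[OF degree_one_lift_truncation[OF F] truncation_mono[OF F] t(2,3)])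
  qed
qed


section \<open>The semiconjugacy to an irrational rotation\<close>

lemma irrational_orbit_dense:
  fixes \<rho> a b :: real
  assumes "\<rho> \<notin> \<rat>" "a < b"
  obtains m n :: int where "a < of_int m + of_int n * \<rho>" "of_int m + of_int n * \<rho> < b"
proof -
  have "(b - a) / 2 > 0" using assms(2) by simp
  then obtain h k :: int where "\<bar>of_int k * \<rho> - of_int h - (a + b) / 2\<bar> < (b - a) / 2"
    using sequence_of_fractional_parts_is_dense[OF assms(1), where \<alpha> = "(a + b) / 2"] by metis
  then have "a < of_int (- h) + of_int k * \<rho>" "of_int (- h) + of_int k * \<rho> < b"
    unfolding of_int_minus by argo+
  then show ?thesis using that by blast
qed

text \<open>A jump of a monotone function leaves a gap in its range.\<close>

lemma continuous_if_mono_dense_range: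
  fixes H :: "real \<Rightarrow> real"
  assumes "mono H" and dense: "\<And>a b. a < b \<Longrightarrow> \<exists>y. a < H y \<and> H y < b"
  shows "continuous_on UNIV H"
proof (unfold continuous_on_iff, intro ballI allI impI)
  fix x e :: real assume "e > 0"
  then obtain y z where yz: "H x < H y" "H y < H x + e" "H x - e < H z" "H z < H x"
    using dense[of "H x" "H x + e"] dense[of "H x - e" "H x"] by auto
  have "x < y" "z < x"
    using yz monoD[OF assms(1), of y x] monoD[OF assms(1), of x z] by linarith+
  moreover have "dist (H x') (H x) < e" if "dist x' x < min (y - x) (x - z)" for x'
    using that yz monoD[OF assms(1), of x' y] monoD[OF assms(1), of z x']
    by (auto simp: dist_real_def abs_less_iff)
  ultimately show "\<exists>d>0. \<forall>x'\<in>UNIV. dist x' x < d \<longrightarrow> dist (H x') (H x) < e"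
    by (intro exI[of _ "min (y - x) (x - z)"]) auto
qed

text \<open>The upper limit of \<open>(G ^^ n) x - n * \<rho>\<close> is finite by the bounded deviation, it is nondecreasing in \<open>x\<close>,
and dropping the first term of the sequence shows that it satisfies the functional equation. As \<open>G\<close>
is onto, the range is thus invariant under the translations by \<open>1\<close> and \<open>\<rho>\<close>; so it is dense and has
no gaps, and the map is continuous.\<close>

theorem poincare_semiconjugacy:
  assumes G: "degree_one_lift G" "mono G" and irr: "\<rho> \<notin> \<rat>"
    and dev: "\<And>n x. \<bar>(G ^^ n) x - x - real n * \<rho>\<bar> \<le> 1"
  obtains H where "degree_one_lift H" "mono H" "\<And>x. H (G x) = H x + \<rho>"
proof -
  (* The infimum of the eventual upper bounds is the real-valued upper limit. *)
  define S where "S x = {c. \<forall>\<^sub>F n in sequentially. (G ^^ n) x - real n * \<rho> \<le> c}" for x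
  define H where "H x = Inf (S x)" for x
  have lower: "x - 1 \<le> c" if "c \<in> S x" for x c
  proof -
    from that obtain n where "(G ^^ n) x - real n * \<rho> \<le> c"
      unfolding S_def eventually_sequentially by auto
    then show ?thesis using dev[of n x] by linarith
  qed
  have ne: "S x \<noteq> {}" for x
  proof -
    have "(G ^^ n) x - real n * \<rho> \<le> x + 1" for n using dev[of n x] by linarith
    then have "x + 1 \<in> S x" by (simp add: S_def)
    then show ?thesis by blast
  qed
  have bdd: "bdd_below (S x)" for x
    using lower by (intro bdd_belowI[of _ "x - 1"])
  have translate: "H y = H x + s" if "\<And>c. c \<in> S y \<longleftrightarrow> c - s \<in> S x" for x y s
  proof (rule antisym)
    have "H y - s \<le> H x"
      unfolding H_def[of x]
    proof (rule cInf_greatest[OF ne])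
      fix c assume "c \<in> S x"
      then have "c + s \<in> S y" using that[of "c + s"] by simp
      then show "H y - s \<le> c" using cInf_lower[OF _ bdd, of "c + s" y] by (simp add: H_def)
    qed
    then show "H y \<le> H x + s" by simp
    show "H x + s \<le> H y"
      unfolding H_def[of y]
    proof (rule cInf_greatest[OF ne])
      fix c assume "c \<in> S y"
      then show "H x + s \<le> c"
        using that[of c] cInf_lower[OF _ bdd, of "c - s" x] by (simp add: H_def)
    qed
  qed
  have semi: "H (G x) = H x + \<rho>" for x
  proof (rule translate)
    fix c
    have "c \<in> S (G x) \<longleftrightarrow> (\<forall>\<^sub>F n in sequentially. (G ^^ Suc n) x - real (Suc n) * \<rho> \<le> c - \<rho>)"
      by (simp add: S_def funpow_Suc_right algebra_simps del: funpow.simps)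
    also have "\<dots> \<longleftrightarrow> c - \<rho> \<in> S x"
      unfolding S_def mem_Collect_eq
      by (rule eventually_sequentially_Suc[where P = "\<lambda>n. (G ^^ n) x - real n * \<rho> \<le> c - \<rho>"])
    finally show "c \<in> S (G x) \<longleftrightarrow> c - \<rho> \<in> S x" .
  qed
  have H1: "H (x + 1) = H x + 1" for x
  proof (rule translate)
    fix c
    have "(G ^^ n) (x + 1) - real n * \<rho> \<le> c \<longleftrightarrow> (G ^^ n) x - real n * \<rho> \<le> c - 1" for n
      using degree_one_lift_add_1[OF degree_one_lift_funpow[OF G(1)], of n x] by linarith
    then show "c \<in> S (x + 1) \<longleftrightarrow> c - 1 \<in> S x" by (simp add: S_def)
  qed
  have mono: "mono H"
  proof (rule monoI)
    fix x y :: real assume "x \<le> y"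
    then have "(G ^^ n) x \<le> (G ^^ n) y" for n using funpow_mono[OF G(2)] by simp
    then have "S y \<subseteq> S x"
      unfolding S_def by (auto elim!: eventually_mono intro: order_trans[OF diff_right_mono])
    then show "H x \<le> H y" unfolding H_def by (intro cInf_superset_mono ne bdd)
  qed
  have range: "\<exists>y. H y = H 0 + (of_int m + of_int n * \<rho>)" for m n
  proof -
    have "\<exists>y. H y = H 0 + of_int n * \<rho>"
    proof (induction n rule: int_induct[where k = 0])
      case (step1 i)
      then obtain y where "H y = H 0 + of_int i * \<rho>" by blast
      then have "H (G y) = H 0 + of_int (i + 1) * \<rho>" by (simp add: semi algebra_simps)
      then show ?case by blast
    next
      case (step2 i)
      then obtain y where y: "H y = H 0 + of_int i * \<rho>" by blast
      obtain z where "G z = y" using degree_one_lift_surj[OF G(1)] by (metis surjD)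
      with y semi[of z] have "H z = H 0 + of_int (i - 1) * \<rho>" by (simp add: algebra_simps)
      then show ?case by blast
    qed auto
    then obtain y where "H y = H 0 + of_int n * \<rho>" by blast
    then have "H (y + of_int m) = H 0 + (of_int m + of_int n * \<rho>)"
      using degree_one_lift_add_int[of H, OF H1] by simp
    then show ?thesis by blast
  qed
  have "\<exists>y. a < H y \<and> H y < b" if "a < b" for a b
  proof -
    have "a - H 0 < b - H 0" using that by simp
    then obtain m n :: int where "a - H 0 < of_int m + of_int n * \<rho>" "of_int m + of_int n * \<rho> < b - H 0"
      using irrational_orbit_dense[OF irr] by metis
    then show ?thesis using range[of m n] by (smt (verit))
  qed
  then have "continuous_on UNIV H" by (rule continuous_if_mono_dense_range[OF mono])
  with H1 have "degree_one_lift H" by (simp add: degree_one_lift_def)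
  from that[OF this mono semi] show ?thesis .
qed

section \<open>Ergodicity of irrational rotations\<close>

lemma translation_invariant_multiple:
  fixes c :: real
  assumes "\<And>x. x + c \<in> B \<longleftrightarrow> x \<in> B"
  shows "x + of_int n * c \<in> B \<longleftrightarrow> x \<in> B"
proof (induction n rule: int_induct[where k = 0])
  case (step1 i)
  then show ?case using assms[of "x + of_int i * c"] by (simp add: algebra_simps)
next
  case (step2 i)
  then show ?case using assms[of "x + of_int (i - 1) * c"] by (simp add: algebra_simps)
qed simp

lemma emeasure_lborel_vimage_plus:
  assumes "B \<in> sets borel"
  shows "emeasure lborel ((+) c -` B) = emeasure lborel (B :: real set)"
proof -
  have "emeasure lborel B = emeasure (distr lborel borel ((+) c)) B"
    by (simp add: lborel_distr_plus)
  also have "\<dots> = emeasure lborel ((+) c -` B)"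
    using assms by (subst emeasure_distr) auto
  finally show ?thesis by simp
qed

lemma measure_invariant_Int_interval_shift:
  assumes B: "B \<in> sets borel" and inv: "\<And>x. x + c \<in> B \<longleftrightarrow> x \<in> B"
  shows "measure lborel (B \<inter> {a + c..<b + c}) = measure lborel (B \<inter> {a..<b :: real})"
proof -
  have "(+) c -` (B \<inter> {a + c..<b + c}) = B \<inter> {a..<b}"
  proof (rule set_eqI)
    show "x \<in> (+) c -` (B \<inter> {a + c..<b + c}) \<longleftrightarrow> x \<in> B \<inter> {a..<b}" for x
      using inv[of x] by (simp add: add.commute)
  qed
  then show ?thesis
    using emeasure_lborel_vimage_plus[of "B \<inter> {a + c..<b + c}" c] B by (simp add: measure_def)
qed

lemma fmeasurable_Int_interval:
  assumes "B \<in> sets borel"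
  shows "B \<inter> {a..<b :: real} \<in> fmeasurable lborel"
  by (rule fmeasurableI2[of "{a..b}"])
    (use assms in \<open>auto intro: fmeasurable_compact\<close>)

lemma measure_Int_interval_split:
  assumes "B \<in> sets borel" "a \<le> b" "b \<le> (c :: real)"
  shows "measure lborel (B \<inter> {a..<c}) = measure lborel (B \<inter> {a..<b}) + measure lborel (B \<inter> {b..<c})"
proof -
  have "B \<inter> {a..<c} = (B \<inter> {a..<b}) \<union> (B \<inter> {b..<c})" using assms by auto
  then show ?thesis
    using assms(1) by (simp only:) (rule measure_Un_AE; force intro: fmeasurable_Int_interval)
qed

lemma measure_Int_interval_le:
  assumes "B \<in> sets borel" "a \<le> (b :: real)"
  shows "measure lborel (B \<inter> {a..<b}) \<le> b - a"
proof -
  have "measure lborel (B \<inter> {a..<b}) \<le> measure lborel {a..<b}"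
    using assms(1) fmeasurable_Int_interval[of UNIV a b] by (intro measure_mono_fmeasurable) auto
  then show ?thesis using assms(2) by simp
qed

text \<open>Nonnegativity makes \<open>\<phi>\<close> monotone, so \<open>n * \<phi> s = \<phi> (n * s)\<close> is squeezed between the values of \<open>\<phi>\<close> at the
two integers around \<open>n * s\<close>; the error \<open>\<phi> 1\<close> disappears after division by a large \<open>n\<close>.\<close>

lemma additive_real_linear:
  fixes \<phi> :: "real \<Rightarrow> real"
  assumes add: "\<And>x y. x \<ge> 0 \<Longrightarrow> y \<ge> 0 \<Longrightarrow> \<phi> (x + y) = \<phi> x + \<phi> y"
    and nn: "\<And>x. x \<ge> 0 \<Longrightarrow> \<phi> x \<ge> 0" and s: "s \<ge> 0"
  shows "\<phi> s = s * \<phi> 1"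
proof -
  have nat: "\<phi> (real n * x) = real n * \<phi> x" if "x \<ge> 0" for n x
  proof (induction n)
    case 0
    show ?case using add[of 0 0] by simp
  next
    case (Suc n)
    have "\<phi> (real n * x + x) = \<phi> (real n * x) + \<phi> x"
      using that by (intro add) auto
    then show ?case using Suc by (simp add: algebra_simps)
  qed
  have mono: "\<phi> x \<le> \<phi> y" if "0 \<le> x" "x \<le> y" for x y
    using add[of x "y - x"] nn[of "y - x"] that by simp
  have "real n * \<bar>\<phi> s - s * \<phi> 1\<bar> \<le> \<phi> 1" for n
  proof -
    define k where "k = nat \<lfloor>real n * s\<rfloor>"
    have k: "real k \<le> real n * s" "real n * s \<le> real k + 1"
      using s by (auto simp: k_def of_nat_floor)
    have "real k * \<phi> 1 \<le> real n * \<phi> s"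
      using mono[of "real k * 1" "real n * s"] k(1) nat[of 1 k] nat[OF s, of n] by simp
    moreover have "real n * \<phi> s \<le> (real k + 1) * \<phi> 1"
      using mono[of "real n * s" "real (Suc k) * 1"] k(2) nat[of 1 "Suc k"] nat[OF s, of n] s
      by (simp add: add.commute)
    moreover have "real k * \<phi> 1 \<le> real n * s * \<phi> 1" "real n * s * \<phi> 1 \<le> (real k + 1) * \<phi> 1"
      using k nn[of 1] by (auto intro: mult_right_mono)
    ultimately have "\<bar>real n * \<phi> s - real n * s * \<phi> 1\<bar> \<le> \<phi> 1"
      by (simp add: abs_le_iff algebra_simps)
    moreover have "real n * \<bar>\<phi> s - s * \<phi> 1\<bar> = \<bar>real n * \<phi> s - real n * s * \<phi> 1\<bar>"
    proof -
      have "real n * \<phi> s - real n * s * \<phi> 1 = real n * (\<phi> s - s * \<phi> 1)"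
        by (simp add: algebra_simps)
      then show ?thesis by (simp add: abs_mult)
    qed
    ultimately show ?thesis by linarith
  qed
  then have "\<not> \<bar>\<phi> s - s * \<phi> 1\<bar> > 0"
    by (metis reals_Archimedean3 not_le)
  then show ?thesis by simp
qed

text \<open>For a shift \<open>b\<close> in the dense group generated by \<open>1\<close> and \<open>\<rho>\<close> the measures of \<open>B\<close> in an interval and in
its translate agree; any \<open>a\<close> is close to such a \<open>b\<close>, and moving the endpoints of an interval by at most
\<open>e\<close> changes the measure by at most \<open>e\<close>.\<close>

lemma measure_dense_invariant_Int_interval:
  assumes B: "B \<in> sets borel" and irr: "\<rho> \<notin> \<rat>"
    and inv1: "\<And>x. x + 1 \<in> B \<longleftrightarrow> x \<in> B" and inv\<rho>: "\<And>x. x + \<rho> \<in> B \<longleftrightarrow> x \<in> B"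
    and s: "s \<ge> (0::real)"
  shows "measure lborel (B \<inter> {a..<a + s}) = measure lborel (B \<inter> {0..<s})"
proof -
  let ?m = "\<lambda>a b. measure lborel (B \<inter> {a..<b})"
  have close: "\<bar>?m a (a + s) - ?m 0 s\<bar> \<le> e" if "e > 0" for e
  proof -
    have "a < a + e" using that by simp
    then obtain k n :: int where kn: "a < of_int k + of_int n * \<rho>" "of_int k + of_int n * \<rho> < a + e"
      using irrational_orbit_dense[OF irr] by metis
    define b where "b = of_int k + of_int n * \<rho>"
    have "x + b \<in> B \<longleftrightarrow> x \<in> B" for x
      using translation_invariant_multiple[OF inv1, of x k]
        translation_invariant_multiple[OF inv\<rho>, of "x + of_int k" n]
      by (simp add: b_def add.assoc)
    then have "?m (0 + b) (s + b) = ?m 0 s"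
      by (rule measure_invariant_Int_interval_shift[OF B])
    then have eq: "?m b (b + s) = ?m 0 s" by (simp add: add.commute)
    have ab: "a \<le> b" "b \<le> a + e" using kn by (auto simp: b_def)
    have "?m a (b + s) = ?m a b + ?m b (b + s)" "?m a (b + s) = ?m a (a + s) + ?m (a + s) (b + s)"
      using ab s by (intro measure_Int_interval_split[OF B]; simp)+
    moreover have "?m a b \<le> e" "?m (a + s) (b + s) \<le> e"
      using measure_Int_interval_le[OF B, of a b] measure_Int_interval_le[OF B, of "a + s" "b + s"] ab
      by linarith+
    moreover have "?m a b \<ge> 0" "?m (a + s) (b + s) \<ge> 0" by simp_all
    ultimately show ?thesis using eq by linarith
  qed
  have "\<bar>?m a (a + s) - ?m 0 s\<bar> \<le> 0"
    by (rule field_le_epsilon) (use close in simp)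
  then show ?thesis by simp
qed

text \<open>By translation invariance \<open>s \<mapsto> measure lborel (B \<inter> {0..<s})\<close> is additive, hence linear with
some slope \<open>c\<close>. So Lebesgue measure restricted to \<open>B\<close> is \<open>c\<close> times Lebesgue measure on all Borel sets.
If \<open>c\<close> is not zero, evaluating both at the complement of \<open>B\<close> shows that this complement is a null
set.\<close>

theorem irrational_rotation_ergodic:
  assumes B: "B \<in> sets borel" and irr: "\<rho> \<notin> \<rat>"
    and inv1: "\<And>x. x + 1 \<in> B \<longleftrightarrow> x \<in> B" and inv\<rho>: "\<And>x. x + \<rho> \<in> B \<longleftrightarrow> x \<in> B"
  shows "emeasure lborel ({0..<1} \<inter> B) = 0 \<or> emeasure lborel ({0..<1::real} \<inter> B) = 1"
proof -
  let ?m = "\<lambda>a b. measure lborel (B \<inter> {a..<b})"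
  define c where "c = ?m 0 1"
  have lin: "?m 0 s = s * c" if "s \<ge> 0" for s
    unfolding c_def
  proof (rule additive_real_linear[OF _ _ that])
    fix x y :: real assume xy: "x \<ge> 0" "y \<ge> 0"
    then show "?m 0 (x + y) = ?m 0 x + ?m 0 y"
      using measure_Int_interval_split[OF B, of 0 x "x + y"]
        measure_dense_invariant_Int_interval[OF B irr inv1 inv\<rho>, of y x] by simp
  qed simp
  have int: "emeasure lborel (B \<inter> {a<..<b}) = ennreal ((b - a) * c)" if "a \<le> b" for a b
  proof -
    have "emeasure lborel (B \<inter> {a<..<b}) = emeasure lborel (B \<inter> {a..<b} - {a})"
      by (rule arg_cong[where f = "emeasure lborel"]) auto
    also have "\<dots> = emeasure lborel (B \<inter> {a..<b})"
      using B by (intro emeasure_Diff_null_set finite_imp_null_set_lborel) auto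
    also have "\<dots> = ennreal (?m a b)"
      using fmeasurable_Int_interval[OF B] by (simp add: emeasure_eq_measure2)
    also have "?m a b = (b - a) * c"
      using measure_dense_invariant_Int_interval[OF B irr inv1 inv\<rho>, of "b - a" a] lin[of "b - a"] that
      by simp
    finally show ?thesis .
  qed
  have c: "emeasure lborel ({0..<1} \<inter> B) = ennreal c"
    using fmeasurable_Int_interval[OF B, of 0 1] by (simp add: emeasure_eq_measure2 c_def Int_commute)
  show ?thesis
  proof (cases "c = 0")
    case True
    then show ?thesis using c by simp
  next
    case False
    then have "c > 0" by (simp add: c_def less_le)
    define N where "N = scale_measure (ennreal (1 / c)) (density lborel (indicator B))"
    have N: "emeasure N E = ennreal (1 / c) * emeasure lborel (B \<inter> E)" if "E \<in> sets borel" for E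
      using that B by (simp add: N_def emeasure_density flip: indicator_inter_arith)
    have "lborel = N"
    proof (rule lborel_eqI)
      show "sets N = sets borel" by (simp add: N_def)
      fix l u :: real assume "\<And>b. b \<in> Basis \<Longrightarrow> l \<bullet> b \<le> u \<bullet> b"
      then have "l \<le> u" by simp
      then show "emeasure N (box l u) = ennreal (\<Prod>b\<in>Basis. (u - l) \<bullet> b)"
        using \<open>c > 0\<close> by (simp add: N int box_real ennreal_mult[symmetric])
    qed
    then have "emeasure lborel (- B) = emeasure N (- B)" by simp
    also have "\<dots> = 0" using B by (subst N) auto
    finally have null: "- B \<in> null_sets lborel" using B by (auto simp: null_sets_def)
    have "emeasure lborel ({0..<1} \<inter> B) = emeasure lborel ({0..<1} - - B)"
      by (rule arg_cong[where f = "emeasure lborel"]) auto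
    also have "\<dots> = emeasure lborel {0..<1::real}" by (rule emeasure_Diff_null_set[OF null]) simp
    finally show ?thesis by simp
  qed
qed

text \<open>Cut the unit interval starting at \<open>a\<close> at the integer inside it and move the right piece back by one
period.\<close>

lemma measure_periodic_Int_unit_interval:
  assumes B: "B \<in> sets borel" and inv1: "\<And>x. x + 1 \<in> B \<longleftrightarrow> x \<in> B"
  shows "emeasure lborel (B \<inter> {a..<a + 1}) = emeasure lborel (B \<inter> {0..<1::real})"
proof -
  let ?m = "\<lambda>a b. measure lborel (B \<inter> {a..<b})"
  define n where "n = real_of_int \<lfloor>a\<rfloor>"
  have n: "n \<le> a" "a \<le> n + 1" unfolding n_def by linarith+
  have invn: "x + of_int k \<in> B \<longleftrightarrow> x \<in> B" for x k
    using translation_invariant_multiple[OF inv1, of x k] by simp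
  have "?m a (a + 1) = ?m a (n + 1) + ?m (n + 1) (a + 1)"
    "?m n (n + 1) = ?m n a + ?m a (n + 1)"
    using n by (intro measure_Int_interval_split[OF B]; simp)+
  moreover have "?m (n + 1) (a + 1) = ?m n a"
    by (rule measure_invariant_Int_interval_shift[OF B inv1])
  moreover have "?m (0 + n) (1 + n) = ?m 0 1"
    unfolding n_def by (rule measure_invariant_Int_interval_shift[OF B invn])
  ultimately have "?m a (a + 1) = ?m 0 1" by (simp add: add.commute)
  then show ?thesis using fmeasurable_Int_interval[OF B] by (simp add: emeasure_eq_measure2)
qed


section \<open>The circle as a quotient of the line\<close>

lemma circle_proj_rep: "circle_proj (rep_circle \<theta>) = \<theta>"
  using rep_circle[of \<theta>] by (simp add: circle_proj_def frac_eq rep_circle_inverse)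

lemma rep_circle_proj: "rep_circle (circle_proj x) = frac x"
  unfolding circle_proj_def by (rule Abs_circle_inverse) (simp add: frac_lt_1)

lemma circle_proj_add_int [simp]: "circle_proj (x + of_int k) = circle_proj x"
  by (simp add: circle_proj_def frac_def)

lemma circle_proj_eqD:
  assumes "circle_proj x = circle_proj y"
  obtains k :: int where "x = y + of_int k"
proof -
  have "frac x = frac y" using assms by (metis rep_circle_proj)
  then have "x = y + of_int (\<lfloor>x\<rfloor> - \<lfloor>y\<rfloor>)" by (simp add: frac_def)
  then show ?thesis using that by blast
qed

lemma circle_projE:
  obtains x where "\<theta> = circle_proj x"
  by (metis circle_proj_rep)

lemma circle_proj_continuous: "continuous_on S circle_proj"
proof -
  have "continuous_on UNIV circle_proj"
    by (auto simp: continuous_on_open_vimage open_circle_def)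
  then show ?thesis using continuous_on_subset by blast
qed

lemma circle_proj_open_map:
  assumes "open W"
  shows "open (circle_proj ` W)"
proof -
  have "circle_proj -` circle_proj ` W = (\<Union>k::int. (+) (of_int k) ` W)"
  proof (intro subset_antisym subsetI)
    fix x assume "x \<in> circle_proj -` circle_proj ` W"
    then obtain w where "w \<in> W" "circle_proj x = circle_proj w" by auto
    moreover then obtain k :: int where "x = w + of_int k" using circle_proj_eqD by blast
    ultimately show "x \<in> (\<Union>k::int. (+) (of_int k) ` W)" by (auto simp: add.commute)
  next
    fix x assume "x \<in> (\<Union>k::int. (+) (of_int k) ` W)"
    then obtain k :: int and w where "w \<in> W" "x = w + of_int k" by (auto simp: add.commute)
    then show "x \<in> circle_proj -` circle_proj ` W" by simp
  qed
  then show ?thesis using assms by (auto simp: open_circle_def open_translation)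
qed

text \<open>The projection is an open map: a neighbourhood of a lifted point avoiding the preimage of \<open>V\<close> projects
to a neighbourhood avoiding \<open>V\<close>.\<close>

lemma vimage_closure_circle_proj_subset:
  "circle_proj -` closure V \<subseteq> closure (circle_proj -` V)"
proof
  fix x assume x: "x \<in> circle_proj -` closure V"
  let ?W = "- closure (circle_proj -` V)"
  have "circle_proj ` ?W \<inter> V = {}" using closure_subset[of "circle_proj -` V"] by auto
  then have "circle_proj ` ?W \<inter> closure V = {}"
    by (subst open_Int_closure_eq_empty) (simp_all add: circle_proj_open_map open_Compl)
  with x show "x \<in> closure (circle_proj -` V)" by auto
qed

lemma circle_map_continuous_iff:
  "continuous_on UNIV g \<longleftrightarrow> continuous_on UNIV (g \<circ> circle_proj)"
  for g :: "circle \<Rightarrow> 'a::topological_space"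
  by (simp add: continuous_on_open_vimage open_circle_def vimage_comp o_def)

lemma closed_circle_singleton: "closed {\<theta> :: circle}"
proof -
  obtain x where x: "\<theta> = circle_proj x" by (rule circle_projE)
  have "circle_proj -` (- {\<theta>}) = - ((+) x ` range of_int)"
  proof (intro set_eqI iffI)
    fix y assume y: "y \<in> circle_proj -` (- {\<theta>})"
    show "y \<in> - ((+) x ` range of_int)"
    proof
      assume "y \<in> (+) x ` range of_int"
      then obtain k :: int where "y = x + of_int k" by auto
      with x y show False by simp
    qed
  next
    fix y assume y: "y \<in> - ((+) x ` range of_int)"
    have "circle_proj y \<noteq> circle_proj x"
    proof
      assume "circle_proj y = circle_proj x"
      then obtain k :: int where "y = x + of_int k" by (rule circle_proj_eqD)
      with y show False by simp
    qed
    with x show "y \<in> circle_proj -` (- {\<theta>})" by simp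
  qed
  moreover have "closed ((+) x ` range (of_int :: int \<Rightarrow> real))"
    by (intro closed_translation closed_of_int_image)
  ultimately show ?thesis by (simp add: closed_def open_circle_def open_Compl)
qed

lemma countable_circle_set_borel: "countable A \<Longrightarrow> A \<in> sets (borel :: circle measure)"
  by (rule sets.countable) (auto intro: borel_closed closed_circle_singleton)

definition circle_map_of_lift :: "(real \<Rightarrow> real) \<Rightarrow> circle \<Rightarrow> circle" where
  "circle_map_of_lift H \<theta> = circle_proj (H (rep_circle \<theta>))"

lemma circle_map_of_lift_proj:
  assumes "degree_one_lift H"
  shows "circle_map_of_lift H (circle_proj x) = circle_proj (H x)"
proof -
  have "H (frac x + of_int \<lfloor>x\<rfloor>) = H (frac x) + of_int \<lfloor>x\<rfloor>"
    by (rule degree_one_lift_add_int[of H, OF degree_one_lift_add_1[OF assms]])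
  moreover have "frac x + of_int \<lfloor>x\<rfloor> = x" by (simp add: frac_def)
  ultimately have "H x = H (frac x) + of_int \<lfloor>x\<rfloor>" by simp
  then show ?thesis by (simp add: circle_map_of_lift_def rep_circle_proj)
qed

lemma circle_rotation_proj: "circle_rotation \<rho> (circle_proj x) = circle_proj (x + \<rho>)"
proof -
  have "x + \<rho> = frac x + \<rho> + of_int \<lfloor>x\<rfloor>" by (simp add: frac_def)
  then show ?thesis by (simp only: circle_rotation_def rep_circle_proj circle_proj_add_int)
qed

lemma lifting_circle_map_of_lift:
  assumes "degree_one_lift H"
  shows "lifting (circle_map_of_lift H) H"
  using degree_one_lift_continuous[OF assms]
  by (auto simp: lifting_def circle_map_of_lift_proj[OF assms])

lemma lifting_continuous:
  assumes "lifting g H"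
  shows "continuous_on UNIV g"
proof -
  have "continuous_on UNIV (circle_proj \<circ> H)"
    using assms by (intro continuous_on_compose circle_proj_continuous) (auto simp: lifting_def)
  then show ?thesis using assms by (simp add: circle_map_continuous_iff lifting_def)
qed

text \<open>Some lifting has degree one by definition; any other one differs from it by a continuous function
with integer values, that is, by a constant.\<close>

lemma degree_one_lift_if_has_degree:
  assumes "has_degree f 1" "lifting f F"
  shows "degree_one_lift F"
proof -
  obtain F0 where F0: "lifting f F0" "\<And>x. F0 (x + 1) = F0 x + 1"
    using assms(1) by (auto simp: has_degree_def)
  have int: "\<exists>k::int. F x - F0 x = of_int k" for x
  proof -
    have "circle_proj (F x) = circle_proj (F0 x)"
      using assms(2) F0(1) unfolding lifting_def by (metis comp_apply)
    then obtain k :: int where "F x = F0 x + of_int k" by (rule circle_proj_eqD)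
    then show ?thesis by (intro exI[of _ k]) simp
  qed
  have "(\<lambda>x. F x - F0 x) constant_on UNIV"
  proof (rule continuous_discrete_range_constant)
    show "continuous_on UNIV (\<lambda>x. F x - F0 x)"
      using assms(2) F0(1) by (intro continuous_intros) (auto simp: lifting_def)
    fix x
    have "1 \<le> norm ((F y - F0 y) - (F x - F0 x))" if "F y - F0 y \<noteq> F x - F0 x" for y
    proof -
      obtain k l :: int where kl: "F x - F0 x = of_int k" "F y - F0 y = of_int l"
        using int[of x] int[of y] by auto
      have "norm (of_int l - of_int k :: real) = of_int \<bar>l - k\<bar>" by simp
      moreover have "\<bar>l - k\<bar> \<ge> 1" using that kl by auto
      ultimately show ?thesis unfolding kl by linarith
    qed
    then show "\<exists>e>0. \<forall>y. y \<in> UNIV \<and> F y - F0 y \<noteq> F x - F0 x \<longrightarrow>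
        e \<le> norm ((F y - F0 y) - (F x - F0 x))"
      by (intro exI[of _ 1]) auto
  qed auto
  then obtain c where "\<And>x. F x = F0 x + c"
    unfolding constant_on_def by (metis UNIV_I add.commute diff_add_cancel)
  then show ?thesis using F0(2) assms(2) by (simp add: degree_one_lift_def lifting_def)
qed

section \<open>The orbit structure carried by a semiconjugacy\<close>

lemma inv_strict_mono_if_mono_surj:
  fixes H :: "real \<Rightarrow> real"
  assumes "mono H" "surj H"
  shows "strict_mono (inv H)"
proof (rule strict_monoI)
  fix x y :: real assume "x < y"
  then show "inv H x < inv H y"
    using monoD[OF assms(1), of "inv H y" "inv H x"] surj_f_inv_f[OF assms(2)]
    by (metis not_le)
qed

text \<open>Here \<open>G\<close> is a modification of the lifting \<open>F\<close> of \<open>f\<close> that changes it only inside plateaus of \<open>G\<close>,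
and \<open>H\<close> semiconjugates \<open>G\<close> to the translation by \<open>\<rho>\<close>. The condition \<open>dev\<close> fixes the rotation
number of \<open>G\<close> in a quantitative form.\<close>

locale irrational_semiconjugacy =
  fixes f :: "circle \<Rightarrow> circle" and F G H :: "real \<Rightarrow> real" and \<rho> :: real
  assumes lift_f: "lifting f F" and F: "degree_one_lift F"
    and G: "degree_one_lift G" and H: "degree_one_lift H" and mono_H: "mono H"
    and irr: "\<rho> \<notin> \<rat>"
    and G_eq_F: "\<And>x. G x \<noteq> F x \<Longrightarrow> locally_constant_at G x"
    and dev: "\<And>n x. \<bar>(G ^^ n) x - x - real n * \<rho>\<bar> \<le> 1"
    and semi: "\<And>x. H (G x) = H x + \<rho>"
begin

text \<open>Every nondegenerate fibre of \<open>H\<close> is an interval and contains a rational number. Removing the full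
rotation orbits of the values of \<open>H\<close> at rational points thus leaves only levels all of whose
translates have a single preimage, while the removed set is countable and invariant.\<close>

definition exceptional :: "real set" where
  "exceptional = {H r + of_int n * \<rho> | r n. r \<in> \<rat>}"

definition regular :: "real set" where
  "regular = {x. H x \<notin> exceptional}"

definition support :: "circle set" where
  "support = circle_proj ` regular"

definition h :: "circle \<Rightarrow> circle" where
  "h = circle_map_of_lift H"

lemma h_proj: "h (circle_proj x) = circle_proj (H x)"
  by (simp add: h_def circle_map_of_lift_proj[OF H])

lemma f_proj: "f (circle_proj x) = circle_proj (F x)"
  using lift_f unfolding lifting_def by (metis comp_apply)

lemma H_add_int: "H (x + of_int k) = H x + of_int k"
  by (rule degree_one_lift_add_int[of H, OF degree_one_lift_add_1[OF H]])

lemma countable_exceptional: "countable exceptional"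
proof -
  have "exceptional = (\<lambda>(r, n). H r + of_int n * \<rho>) ` (\<rat> \<times> (UNIV :: int set))"
    by (auto simp: exceptional_def)
  then show ?thesis by (simp add: countable_rat)
qed

lemma exceptional_add:
  assumes "c \<in> exceptional"
  shows "c + of_int k \<in> exceptional" "c + of_int k * \<rho> \<in> exceptional"
proof -
  obtain r n where c: "c = H r + of_int n * \<rho>" "r \<in> \<rat>"
    using assms by (auto simp: exceptional_def)
  have "c + of_int k = H (r + of_int k) + of_int n * \<rho>"
    using c by (simp add: H_add_int)
  moreover have "r + of_int k \<in> \<rat>" using c(2) by simp
  ultimately show "c + of_int k \<in> exceptional" unfolding exceptional_def by blast
  have "c + of_int k * \<rho> = H r + of_int (n + k) * \<rho>"
    using c by (simp add: algebra_simps)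
  then show "c + of_int k * \<rho> \<in> exceptional" unfolding exceptional_def using c(2) by blast
qed

lemma exceptional_add_int: "c + of_int k \<in> exceptional \<longleftrightarrow> c \<in> exceptional"
  using exceptional_add(1)[of c k] exceptional_add(1)[of "c + of_int k" "- k"] by auto

lemma exceptional_add_rho: "c + \<rho> \<in> exceptional \<longleftrightarrow> c \<in> exceptional"
  using exceptional_add(2)[of c 1] exceptional_add(2)[of "c + \<rho>" "- 1"] by auto

lemma regular_fibre:
  assumes "x \<in> regular" "H y = H x"
  shows "y = x"
proof (rule ccontr)
  assume "y \<noteq> x"
  then have "min x y < max x y" by (simp add: min_def max_def)
  then obtain r where r: "r \<in> \<rat>" "min x y < r" "r < max x y"
    using Rats_dense_in_real by blast
  have "H (min x y) = H x" "H (max x y) = H x" using assms(2) by (auto simp: min_def max_def)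
  then have "H r = H x"
    using monoD[OF mono_H, of "min x y" r] monoD[OF mono_H, of r "max x y"] r by auto
  then have "H x = H r + of_int 0 * \<rho>" by simp
  then have "H x \<in> exceptional" unfolding exceptional_def using r(1) by blast
  with assms(1) show False by (simp add: regular_def)
qed

lemma vimage_support: "circle_proj -` support = regular"
proof -
  have "x \<in> regular" if "circle_proj x = circle_proj y" "y \<in> regular" for x y
  proof -
    from that(1) obtain k :: int where "x = y + of_int k" by (rule circle_proj_eqD)
    with that(2) show ?thesis by (simp add: regular_def H_add_int exceptional_add_int)
  qed
  then show ?thesis by (auto simp: support_def)
qed

lemma proj_mem_support: "circle_proj x \<in> support \<longleftrightarrow> x \<in> regular"
  using vimage_support by auto

text \<open>On a plateau of \<open>G\<close> the functional equation makes \<open>H\<close> constant, too, whereas fibres of regular points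
are singletons. So regular points stay away from the plateaus, and outside the plateaus \<open>G\<close> is \<open>F\<close>.\<close>

lemma not_locally_constant_on_closure_regular:
  assumes "x \<in> closure regular"
  shows "\<not> locally_constant_at G x"
proof
  assume "locally_constant_at G x"
  then obtain e where e: "e > 0" "\<And>y. \<bar>y - x\<bar> < e \<Longrightarrow> G y = G x"
    unfolding locally_constant_at_def by blast
  have Hc: "H y = H x" if "\<bar>y - x\<bar> < e" for y
    using semi[of y] semi[of x] e(2)[OF that] by simp
  obtain r where r: "r \<in> regular" "dist r x < e"
    using assms e(1) unfolding closure_approachable by blast
  have "y = r" if "\<bar>y - x\<bar> < e" for y
    using regular_fibre[OF r(1), of y] Hc[OF that] Hc[of r] r(2) by (simp add: dist_real_def)
  from this[of x] this[of "x + e / 2"] show False using e(1) by simp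
qed

lemma F_eq_G_on_closure_regular: "x \<in> closure regular \<Longrightarrow> F x = G x"
  using not_locally_constant_on_closure_regular G_eq_F by metis

lemma F_eq_G_on_regular: "x \<in> regular \<Longrightarrow> F x = G x"
  using F_eq_G_on_closure_regular closure_subset by blast

lemma G_regular_iff: "G x \<in> regular \<longleftrightarrow> x \<in> regular"
  by (simp add: regular_def semi exceptional_add_rho)

lemma f_proj_regular: "x \<in> regular \<Longrightarrow> f (circle_proj x) = circle_proj (G x)"
  by (simp add: f_proj F_eq_G_on_regular)

lemma invariant_support: "invariant_set f support"
  unfolding invariant_set_def
proof (intro subset_antisym subsetI)
  fix \<theta> assume "\<theta> \<in> f ` support"
  then show "\<theta> \<in> support"
    by (auto simp: support_def f_proj_regular G_regular_iff)
next
  fix \<theta> assume "\<theta> \<in> support"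
  then obtain y where y: "\<theta> = circle_proj y" "y \<in> regular" by (auto simp: support_def)
  obtain x where "G x = y" using degree_one_lift_surj[OF G] by (metis surjD)
  with y have "x \<in> regular" "\<theta> = f (circle_proj x)"
    by (auto simp: f_proj_regular G_regular_iff)
  then show "\<theta> \<in> f ` support" by (auto simp: support_def)
qed

text \<open>The closure of the regular points is invariant under \<open>G\<close>, and \<open>F\<close> agrees with \<open>G\<close> there; so \<open>F\<close>-orbits
starting in it are \<open>G\<close>-orbits, which deviate from the speed \<open>\<rho>\<close> by a bounded amount.\<close>

lemma rotation_number_closure_support:
  assumes "x \<in> circle_proj -` closure support"
  shows "rotation_number F x = \<rho>"
proof -
  have x: "x \<in> closure regular"
    using assms vimage_closure_circle_proj_subset[of support] by (auto simp: vimage_support)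
  have inv: "G y \<in> closure regular" if "y \<in> closure regular" for y
  proof -
    have "G ` closure regular \<subseteq> closure regular"
      using G_regular_iff closure_subset[of regular]
      by (intro image_closure_subset degree_one_lift_continuous[OF G]) auto
    with that show ?thesis by blast
  qed
  have *: "(F ^^ n) x = (G ^^ n) x \<and> (G ^^ n) x \<in> closure regular" for n
    by (induction n) (auto simp: x inv F_eq_G_on_closure_regular)
  have "x + real n * \<rho> - 1 \<le> (F ^^ n) x" "(F ^^ n) x \<le> x + real n * \<rho> + 1" for n
    using *[of n] dev[of n x] by linarith+
  then show ?thesis
    using rotation_number_ge[OF F, of x \<rho> 1] rotation_number_le[OF F, of x \<rho> 1] by fastforce
qed

lemma lifting_h: "lifting h H"
  unfolding h_def by (rule lifting_circle_map_of_lift[OF H])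

lemma continuous_h: "continuous_on S h"
  using lifting_continuous[OF lifting_h] continuous_on_subset by blast

lemma image_support: "h ` support = circle_proj ` (- exceptional)"
proof -
  have "H ` regular = - exceptional"
    using degree_one_lift_surj[OF H] by (force simp: regular_def surj_def)
  then show ?thesis by (simp add: support_def image_image h_proj flip: image_image[of circle_proj H])
qed

lemma proj_mem_image_support: "circle_proj c \<in> h ` support \<longleftrightarrow> c \<notin> exceptional"
  unfolding image_support using exceptional_add_int by (auto elim!: circle_proj_eqD)

lemma inj_on_h: "inj_on h support"
proof (rule inj_onI)
  fix \<theta> \<eta> assume "\<theta> \<in> support" "\<eta> \<in> support" and eq: "h \<theta> = h \<eta>"
  then obtain x y where xy: "\<theta> = circle_proj x" "\<eta> = circle_proj y" "x \<in> regular"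
    by (auto simp: support_def)
  from eq xy have "circle_proj (H y) = circle_proj (H x)" by (simp add: h_proj)
  then obtain k :: int where "H y = H x + of_int k" by (rule circle_proj_eqD)
  then have "H (y + of_int (- k)) = H x" unfolding H_add_int by simp
  from regular_fibre[OF xy(3) this] have "x = y + of_int (- k)" by simp
  with xy show "\<theta> = \<eta>" by (simp only: circle_proj_add_int)
qed

text \<open>Around a regular point \<open>x\<close> the map \<open>H\<close> is strictly separated from its values at \<open>x - e / 2\<close> and
\<open>x + e / 2\<close>, so levels strictly between these two values have all their preimages within \<open>e / 2\<close>
of \<open>x\<close>.\<close>

lemma inv_into_h_continuous: "continuous_on (h ` support) (inv_into support h)"
  unfolding continuous_on_topological
proof (intro ballI allI impI)
  fix \<theta> B assume \<theta>: "\<theta> \<in> h ` support" and B: "open B" "inv_into support h \<theta> \<in> B"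
  from \<theta> obtain x where x: "x \<in> regular" "\<theta> = circle_proj (H x)"
    by (auto simp: support_def h_proj)
  have inv: "inv_into support h (circle_proj (H y)) = circle_proj y" if "y \<in> regular" for y
    using inv_into_f_f[OF inj_on_h, of "circle_proj y"] that by (simp add: h_proj proj_mem_support)
  have "open (circle_proj -` B)" "x \<in> circle_proj -` B"
    using B inv[OF x(1)] x(2) by (auto simp: open_circle_def)
  then obtain e where e: "e > 0" "\<And>y. \<bar>y - x\<bar> < e \<Longrightarrow> circle_proj y \<in> B"
    unfolding open_dist dist_real_def by (metis vimage_eq)
  let ?A = "circle_proj ` {H (x - e / 2)<..<H (x + e / 2)}"
  have "H (x - e / 2) \<noteq> H x" "H (x + e / 2) \<noteq> H x"
    using regular_fibre[OF x(1), of "x - e / 2"] regular_fibre[OF x(1), of "x + e / 2"] e(1) by auto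
  then have "H (x - e / 2) < H x" "H x < H (x + e / 2)"
    using monoD[OF mono_H, of "x - e / 2" x] monoD[OF mono_H, of x "x + e / 2"] e(1) by auto
  then have "\<theta> \<in> ?A" using x(2) by auto
  moreover have "inv_into support h \<eta> \<in> B" if "\<eta> \<in> h ` support" "\<eta> \<in> ?A" for \<eta>
  proof -
    from that(2) obtain c where c: "\<eta> = circle_proj c" "H (x - e / 2) < c" "c < H (x + e / 2)"
      by auto
    with that(1) have "c \<notin> exceptional" by (simp add: proj_mem_image_support)
    moreover obtain y where y: "c = H y" using degree_one_lift_surj[OF H] by (metis surjD)
    ultimately have "y \<in> regular" by (simp add: regular_def)
    have "x - e / 2 < y" "y < x + e / 2"
      using c(2,3) y monoD[OF mono_H, of y "x - e / 2"] monoD[OF mono_H, of "x + e / 2" y]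
      by linarith+
    then have "circle_proj y \<in> B" using e(1) by (intro e(2)) (auto simp: abs_less_iff)
    then show ?thesis using inv[OF \<open>y \<in> regular\<close>] c(1) y by simp
  qed
  ultimately show "\<exists>A. open A \<and> \<theta> \<in> A \<and> (\<forall>\<eta>\<in>h ` support. \<eta> \<in> A \<longrightarrow> inv_into support h \<eta> \<in> B)"
    by (intro exI[of _ ?A]) (auto simp: circle_proj_open_map)
qed

lemma homeomorphism_h: "homeomorphism support (h ` support) h (inv_into support h)"
  by (intro homeomorphismI continuous_h inv_into_h_continuous)
    (auto simp: inj_on_h f_inv_into_f inv_into_into)

lemma closure_image_support: "closure (h ` support) = UNIV"
proof -
  have False if "\<theta> \<notin> closure (h ` support)" for \<theta>
  proof -
    obtain x where x: "\<theta> = circle_proj x" by (rule circle_projE)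
    let ?W = "circle_proj -` (- closure (h ` support))"
    have "open ?W"
      using open_Compl[OF closed_closure, of "h ` support"] by (simp add: open_circle_def)
    moreover have "?W \<noteq> {}" using that x by auto
    ultimately have "\<exists>c\<in>?W. c \<notin> exceptional"
      by (intro open_minus_countable[OF countable_exceptional])
    then obtain c where "c \<in> ?W" "c \<notin> exceptional" ..
    then show False using proj_mem_image_support[of c] closure_subset[of "h ` support"] by auto
  qed
  then show ?thesis by blast
qed

lemma invariant_image_support: "invariant_set (circle_rotation \<rho>) (h ` support)"
proof -
  have "c \<in> (\<lambda>c. c + \<rho>) ` (- exceptional)" if "c \<in> - exceptional" for c
  proof (rule image_eqI)
    show "c = (c - \<rho>) + \<rho>" by simp
    show "c - \<rho> \<in> - exceptional" using that exceptional_add_rho[of "c - \<rho>"] by simp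
  qed
  then have "- exceptional \<subseteq> (\<lambda>c. c + \<rho>) ` (- exceptional)" by (rule subsetI)
  moreover have "(\<lambda>c. c + \<rho>) ` (- exceptional) \<subseteq> - exceptional"
    by (rule image_subsetI) (simp add: exceptional_add_rho)
  ultimately have "(\<lambda>c. c + \<rho>) ` (- exceptional) = - exceptional" by (intro subset_antisym)
  moreover have "circle_rotation \<rho> ` circle_proj ` (- exceptional)
      = circle_proj ` (\<lambda>c. c + \<rho>) ` (- exceptional)"
    by (simp add: image_image circle_rotation_proj)
  ultimately show ?thesis by (simp add: invariant_set_def image_support)
qed

text \<open>The complement of the support is the preimage under \<open>h\<close> of a countable set.\<close>

lemma support_borel: "support \<in> sets borel"
proof -
  have "h \<in> borel_measurable borel" by (intro borel_measurable_continuous_onI continuous_h)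
  moreover have "circle_proj ` exceptional \<in> sets borel"
    using countable_exceptional by (intro countable_circle_set_borel countable_image)
  ultimately have "h -` (circle_proj ` exceptional) \<in> sets borel"
    by (metis (no_types) in_borel_measurable_borel inf_top_right space_borel)
  moreover have "support = - (h -` (circle_proj ` exceptional))"
  proof (rule set_eqI)
    fix \<theta>
    obtain x where x: "\<theta> = circle_proj x" by (rule circle_projE)
    have "circle_proj (H x) \<in> circle_proj ` exceptional \<longleftrightarrow> H x \<in> exceptional"
      using exceptional_add_int by (auto elim!: circle_proj_eqD)
    then show "\<theta> \<in> support \<longleftrightarrow> \<theta> \<in> - (h -` (circle_proj ` exceptional))"
      by (simp add: x h_proj proj_mem_support regular_def)
  qed
  ultimately show ?thesis by simp
qed

lemma h_conjugates:
  assumes "\<theta> \<in> support"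
  shows "h (f \<theta>) = circle_rotation \<rho> (h \<theta>)"
proof -
  obtain x where "\<theta> = circle_proj x" "x \<in> regular" using assms by (auto simp: support_def)
  then show ?thesis by (simp add: f_proj_regular h_proj semi circle_rotation_proj)
qed

lemma f_in_support: "\<theta> \<in> support \<Longrightarrow> f \<theta> \<in> support"
  using invariant_support unfolding invariant_set_def by blast

lemma support_nonempty: "support \<noteq> {}"
  using closure_image_support by auto

text \<open>A right inverse of the semiconjugacy, seen as a map from levels to the circle. On exceptional levels
the choice of the preimage is arbitrary, which is harmless because they form a null set. The measure
below is the image of the uniform distribution on the circle of levels.\<close>

definition arc_section :: "real \<Rightarrow> circle" where
  "arc_section c = circle_proj (inv H c)"

definition \<mu> :: "circle measure" where
  "\<mu> = distr (uniform_measure lborel {0..<1}) borel arc_section"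

lemma H_inv: "H (inv H c) = c"
  by (rule surj_f_inv_f[OF degree_one_lift_surj[OF H]])

lemma inv_H_unique: "H y = c \<Longrightarrow> c \<notin> exceptional \<Longrightarrow> inv H c = y"
  using regular_fibre[of y "inv H c"] by (simp add: regular_def H_inv)

lemma arc_section_add_1:
  assumes "c \<notin> exceptional"
  shows "arc_section (c + 1) = arc_section c"
proof -
  have "inv H (c + 1) = inv H c + of_int 1"
    using assms exceptional_add_int[of c 1]
    by (intro inv_H_unique) (auto simp: H_add_int[of _ 1, simplified] H_inv)
  then show ?thesis by (simp only: arc_section_def circle_proj_add_int)
qed

lemma arc_section_add_rho:
  assumes "c \<notin> exceptional"
  shows "arc_section (c + \<rho>) = f (arc_section c)"
proof -
  have "inv H (c + \<rho>) = G (inv H c)"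
    using assms by (intro inv_H_unique) (auto simp: semi H_inv exceptional_add_rho)
  moreover have "inv H c \<in> regular" using assms by (simp add: regular_def H_inv)
  ultimately show ?thesis by (simp add: arc_section_def f_proj_regular)
qed

lemma arc_section_in_support: "arc_section c \<in> support \<longleftrightarrow> c \<notin> exceptional"
  by (simp add: arc_section_def proj_mem_support regular_def H_inv)

lemma arc_section_measurable [measurable]: "arc_section \<in> borel_measurable borel"
proof -
  have "inv H \<in> borel_measurable borel"
    by (intro borel_measurable_mono strict_mono_mono inv_strict_mono_if_mono_surj mono_H
        degree_one_lift_surj[OF H])
  moreover have "circle_proj \<in> borel_measurable borel"
    by (intro borel_measurable_continuous_onI circle_proj_continuous)
  ultimately show ?thesis
    using measurable_compose unfolding arc_section_def[abs_def] by blast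
qed

lemma vimage_arc_section_borel: "A \<in> sets borel \<Longrightarrow> arc_section -` A \<in> sets borel"
  using measurable_sets[OF arc_section_measurable] by simp

text \<open>The levels outside the null set of exceptional ones whose preimage lies in \<open>A\<close>. Without the
exceptional levels this set is exactly, not only almost everywhere, periodic and equivariant.\<close>

definition lifted :: "circle set \<Rightarrow> real set" where
  "lifted A = arc_section -` A - exceptional"

lemma lifted_borel: "A \<in> sets borel \<Longrightarrow> lifted A \<in> sets borel"
  unfolding lifted_def
  by (rule sets.Diff[OF vimage_arc_section_borel sets.countable[OF _ countable_exceptional]]) simp_all

lemma lifted_add_1: "c + 1 \<in> lifted A \<longleftrightarrow> c \<in> lifted A"
  using exceptional_add_int[of c 1]
  by (cases "c \<in> exceptional") (simp_all add: lifted_def arc_section_add_1)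

lemma lifted_vimage: "lifted (f -` A) = (+) \<rho> -` lifted A"
proof (rule set_eqI)
  show "c \<in> lifted (f -` A) \<longleftrightarrow> c \<in> (+) \<rho> -` lifted A" for c
    by (cases "c \<in> exceptional")
      (simp_all add: lifted_def add.commute[of \<rho> c] arc_section_add_rho exceptional_add_rho)
qed

lemma emeasure_\<mu>:
  assumes "A \<in> sets borel"
  shows "emeasure \<mu> A = emeasure lborel ({0..<1} \<inter> lifted A)"
proof -
  have "emeasure \<mu> A = emeasure lborel ({0..<1} \<inter> arc_section -` A)"
    using assms vimage_arc_section_borel[OF assms] unfolding \<mu>_def
    by (subst emeasure_distr) (auto simp: divide_ennreal_def)
  also have "\<dots> = emeasure lborel ({0..<1} \<inter> arc_section -` A - exceptional)"
    using countable_imp_null_set_lborel[OF countable_exceptional] vimage_arc_section_borel[OF assms]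
    by (simp add: emeasure_Diff_null_set)
  finally show ?thesis by (simp add: lifted_def Int_Diff)
qed

lemma emeasure_support: "emeasure \<mu> support = 1"
proof -
  have "emeasure \<mu> support = emeasure lborel ({0..<1} - exceptional)"
    unfolding emeasure_\<mu>[OF support_borel] by (rule arg_cong[where f = "emeasure lborel"])
      (auto simp: lifted_def arc_section_in_support)
  then show ?thesis
    by (simp add: emeasure_Diff_null_set countable_imp_null_set_lborel[OF countable_exceptional])
qed

text \<open>The section conjugates the rotation by \<open>\<rho>\<close> to \<open>f\<close> off the exceptional levels, so invariance and
ergodicity of Lebesgue measure under the rotation carry over to its image.\<close>

lemma ergodic: "ergodic_measure f \<mu>"
  unfolding ergodic_measure_def
proof (intro conjI ballI impI)
  have "prob_space (uniform_measure lborel {0..<1::real})"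
    by (rule prob_space_uniform_measure) auto
  then show "prob_space \<mu>"
    unfolding \<mu>_def by (rule prob_space.prob_space_distr) auto
  show "sets \<mu> = sets borel" by (simp add: \<mu>_def)
  show f: "f \<in> borel_measurable borel"
    by (intro borel_measurable_continuous_onI lifting_continuous[OF lift_f])
  fix A :: "circle set" assume A: "A \<in> sets borel"
  then have fA: "f -` A \<in> sets borel" using measurable_sets[OF f A] by simp
  have B: "lifted A \<in> sets borel" by (rule lifted_borel[OF A])
  have "emeasure \<mu> (f -` A) = emeasure lborel ((+) \<rho> -` ({\<rho>..<\<rho> + 1} \<inter> lifted A))"
    unfolding emeasure_\<mu>[OF fA] lifted_vimage
    by (rule arg_cong[where f = "emeasure lborel"]) auto
  also have "\<dots> = emeasure lborel ({\<rho>..<\<rho> + 1} \<inter> lifted A)"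
    using B by (intro emeasure_lborel_vimage_plus) auto
  also have "\<dots> = emeasure \<mu> A"
    using measure_periodic_Int_unit_interval[OF B lifted_add_1, of \<rho>]
    by (simp add: emeasure_\<mu>[OF A] Int_commute)
  finally show "emeasure \<mu> (f -` A) = emeasure \<mu> A" .
  assume "f -` A = A"
  then have "c + \<rho> \<in> lifted A \<longleftrightarrow> c \<in> lifted A" for c
    using lifted_vimage[of A] by (auto simp: add.commute)
  then show "emeasure \<mu> A = 0 \<or> emeasure \<mu> A = 1"
    unfolding emeasure_\<mu>[OF A] by (rule irrational_rotation_ergodic[OF B irr lifted_add_1])
qed

text \<open>The conjugacy holds over the support only, so the induction has to carry along that the base point
stays there.\<close>

lemma skew_prod_semiconjugate:
  assumes "\<theta> \<in> support"
  shows "(skew_prod (circle_rotation \<rho>) p (q \<circ> inv_into support h) ^^ n) (h \<theta>, x)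
      = map_prod h id ((skew_prod f p q ^^ n) (\<theta>, x))
    \<and> fst ((skew_prod f p q ^^ n) (\<theta>, x)) \<in> support"
proof (induction n)
  case (Suc n)
  obtain \<eta> y where \<eta>y: "(skew_prod f p q ^^ n) (\<theta>, x) = (\<eta>, y)" by fastforce
  with Suc show ?case
    by (simp add: skew_prod_def h_conjugates f_in_support inv_into_f_f[OF inj_on_h])
qed (simp add: assms)

text \<open>On \<open>support \<times> K\<close> the map \<open>(\<theta>, x) \<mapsto> (h \<theta>, x)\<close> is a bijection that conjugates the two
skew-products and does not touch the second coordinate, in which the attraction takes place.\<close>

theorem attracting_set_transfer:
  assumes gen: "generates_attracting_set (circle_rotation \<rho>)
      (skew_prod (circle_rotation \<rho>) p (q \<circ> inv_into support h)) K (h ` support) \<phi>"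
    and pq: "\<And>x \<theta>. x \<in> K \<Longrightarrow> p x * q \<theta> \<in> K"
  shows "generates_attracting_set f (skew_prod f p q) K support (\<phi> \<circ> h)"
proof -
  let ?S = "skew_prod (circle_rotation \<rho>) p (q \<circ> inv_into support h)"
  let ?T = "skew_prod f p q"
  have S: "?S (h \<theta>, x) = (h (f \<theta>), p x * q \<theta>)" if "\<theta> \<in> support" for \<theta> x
    using that by (simp add: skew_prod_def h_conjugates inv_into_f_f[OF inj_on_h])
  have corr: "correspondence (h ` support) K \<phi>"
    and inv: "?S ` graph_corr (h ` support) \<phi> = graph_corr (h ` support) \<phi>"
    and attr: "\<And>\<theta>. \<theta> \<in> support \<Longrightarrow> \<exists>B\<in>sets lebesgue. B \<subseteq> K \<and> emeasure lebesgue B > 0 \<and>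
        (\<forall>x\<in>B. \<exists>z\<in>\<phi> (h \<theta>). (\<lambda>n. \<bar>snd ((?S ^^ n) (h \<theta>, x)) - snd ((?S ^^ n) (h \<theta>, z))\<bar>) \<longlonglongrightarrow> 0)"
    using gen unfolding generates_attracting_set_def invariant_set_def by blast+
  have "?T ` graph_corr support (\<phi> \<circ> h) = graph_corr support (\<phi> \<circ> h)"
  proof (intro subset_antisym subsetI)
    fix w assume "w \<in> ?T ` graph_corr support (\<phi> \<circ> h)"
    then obtain \<theta> x where \<theta>x: "w = (f \<theta>, p x * q \<theta>)" "\<theta> \<in> support" "x \<in> \<phi> (h \<theta>)"
      by (auto simp: graph_corr_def skew_prod_def)
    then have "(h \<theta>, x) \<in> graph_corr (h ` support) \<phi>" by (auto simp: graph_corr_def)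
    then have "?S (h \<theta>, x) \<in> graph_corr (h ` support) \<phi>" using inv by blast
    then show "w \<in> graph_corr support (\<phi> \<circ> h)"
      using \<theta>x by (simp add: S graph_corr_def f_in_support)
  next
    fix w assume "w \<in> graph_corr support (\<phi> \<circ> h)"
    then obtain \<theta> x where \<theta>x: "w = (\<theta>, x)" "\<theta> \<in> support" "x \<in> \<phi> (h \<theta>)"
      by (auto simp: graph_corr_def)
    then have "(h \<theta>, x) \<in> ?S ` graph_corr (h ` support) \<phi>"
      unfolding inv by (auto simp: graph_corr_def)
    then obtain \<eta> y where \<eta>y: "\<eta> \<in> support" "y \<in> \<phi> (h \<eta>)" "(h \<theta>, x) = ?S (h \<eta>, y)"
      by (auto simp: graph_corr_def)
    then have "h \<theta> = h (f \<eta>)" "x = p y * q \<eta>" by (simp_all add: S)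
    then have "w = ?T (\<eta>, y)"
      using inj_onD[OF inj_on_h, of \<theta> "f \<eta>"] \<theta>x \<eta>y f_in_support by (simp add: skew_prod_def)
    then show "w \<in> ?T ` graph_corr support (\<phi> \<circ> h)"
      using \<eta>y(1,2) by (auto simp: graph_corr_def)
  qed
  moreover have "snd ((?S ^^ n) (h \<theta>, x)) = snd ((?T ^^ n) (\<theta>, x))" if "\<theta> \<in> support" for n \<theta> x
    using skew_prod_semiconjugate[OF that] by simp
  then have "\<exists>B\<in>sets lebesgue. B \<subseteq> K \<and> emeasure lebesgue B > 0 \<and>
      (\<forall>x\<in>B. \<exists>z\<in>(\<phi> \<circ> h) \<theta>. (\<lambda>n. \<bar>snd ((?T ^^ n) (\<theta>, x)) - snd ((?T ^^ n) (\<theta>, z))\<bar>) \<longlonglongrightarrow> 0)"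
    if "\<theta> \<in> support" for \<theta>
    using attr[OF that] that by simp
  moreover have "correspondence support K (\<phi> \<circ> h)"
    using corr by (auto simp: correspondence_def)
  moreover have "\<exists>\<mu>. ergodic_measure f \<mu> \<and> emeasure \<mu> support = 1"
    using ergodic emeasure_support by blast
  ultimately show ?thesis
    using pq support_borel invariant_support
    unfolding generates_attracting_set_def by (simp add: skew_prod_def invariant_set_def)
qed

end


section \<open>All irrational rotation numbers at once\<close>

lemma irrational_semiconjugacy_exists:
  assumes f: "lifting f F" "degree_one_lift F"
    and \<rho>: "\<rho>1 \<in> rotation_set F" "\<rho>2 \<in> rotation_set F" "\<rho>1 \<le> \<rho>" "\<rho> \<le> \<rho>2" "\<rho> \<notin> \<rat>"
  shows "\<exists>G H. irrational_semiconjugacy f F G H \<rho>"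
proof -
  obtain G where G: "degree_one_lift G" "mono G"
    "\<And>x. G x \<noteq> F x \<Longrightarrow> locally_constant_at G x"
    "\<And>n x. \<bar>(G ^^ n) x - x - real n * \<rho>\<bar> \<le> 1"
    using monotone_truncation_with_rotation_number[OF f(2) \<rho>(1-4)] by metis
  obtain H where "degree_one_lift H" "mono H" "\<And>x. H (G x) = H x + \<rho>"
    using poincare_semiconjugacy[OF G(1,2) \<rho>(5) G(4)] by metis
  with f G \<rho>(5) have "irrational_semiconjugacy f F G H \<rho>" by unfold_locales
  then show ?thesis by blast
qed

text \<open>Every irrational number between two rotation numbers is realised by a truncation and hence is the
rotation number of some point under \<open>F\<close>.\<close>

lemma uncountable_irrational_rotation_set:
  assumes f: "lifting f F" "degree_one_lift F" and "\<not> is_singleton (rotation_set F)"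
  shows "uncountable (irrational_rotation_set F)"
proof -
  have "rotation_number F 0 \<in> rotation_set F" by (simp add: rotation_set_def)
  then obtain a b where ab: "a \<in> rotation_set F" "b \<in> rotation_set F" "a \<noteq> b"
    using assms(3) unfolding is_singleton_def by blast
  define \<rho>1 \<rho>2 where "\<rho>1 = min a b" and "\<rho>2 = max a b"
  have \<rho>: "\<rho>1 \<in> rotation_set F" "\<rho>2 \<in> rotation_set F" "\<rho>1 < \<rho>2"
    using ab by (auto simp: \<rho>1_def \<rho>2_def min_def max_def)
  have "\<rho> \<in> irrational_rotation_set F" if "\<rho> \<in> {\<rho>1<..<\<rho>2} - \<rat>" for \<rho>
  proof -
    have "\<rho>1 \<le> \<rho>" "\<rho> \<le> \<rho>2" "\<rho> \<notin> \<rat>" using that by auto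
    then obtain G H where "irrational_semiconjugacy f F G H \<rho>"
      using irrational_semiconjugacy_exists[OF f \<rho>(1,2)] by blast
    then interpret irrational_semiconjugacy f F G H \<rho> .
    obtain x where "circle_proj x \<in> closure support"
      using support_nonempty closure_subset circle_projE by (metis equals0I subsetD)
    then have "rotation_number F x = \<rho>" by (intro rotation_number_closure_support) simp
    then show ?thesis using that by (auto simp: irrational_rotation_set_def rotation_set_def)
  qed
  then have "{\<rho>1<..<\<rho>2} - \<rat> \<subseteq> irrational_rotation_set F" by (rule subsetI)
  moreover have "uncountable ({\<rho>1<..<\<rho>2} - \<rat>)"
    using \<rho>(3) by (intro uncountable_minus_countable countable_rat) (simp add: uncountable_open_interval)
  ultimately show ?thesis using countable_subset by blast
qed

lemma closure_graph_corr_subset: "closure (graph_corr U \<phi>) \<subseteq> closure U \<times> UNIV"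
  using closure_subset[of U]
  by (intro closure_minimal closed_Times) (auto simp: graph_corr_def)

text \<open>The closure of a graph lies over the closure of its base, so nonempty graphs over bases with disjoint
closures have distinct closures.\<close>

lemma inj_on_closure_graph_corr:
  assumes disj: "disjoint_family_on (\<lambda>\<rho>. closure (U \<rho>)) I"
    and ne: "\<And>\<rho>. \<rho> \<in> I \<Longrightarrow> graph_corr (U \<rho>) (\<phi> \<rho>) \<noteq> {}"
  shows "inj_on (\<lambda>\<rho>. closure (graph_corr (U \<rho>) (\<phi> \<rho>))) I"
proof (rule inj_onI)
  fix \<rho> \<sigma> assume I: "\<rho> \<in> I" "\<sigma> \<in> I"
    and eq: "closure (graph_corr (U \<rho>) (\<phi> \<rho>)) = closure (graph_corr (U \<sigma>) (\<phi> \<sigma>))"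
  obtain w where "w \<in> closure (graph_corr (U \<rho>) (\<phi> \<rho>))"
    using ne[OF I(1)] closure_subset by blast
  then have "fst w \<in> closure (U \<rho>) \<inter> closure (U \<sigma>)"
    using eq closure_graph_corr_subset[of "U \<rho>" "\<phi> \<rho>"] closure_graph_corr_subset[of "U \<sigma>" "\<phi> \<sigma>"]
    by auto
  then show "\<rho> = \<sigma>" using disj I by (auto simp: disjoint_family_on_def)
qed

theorem theorem1:
  fixes K :: "real set"
    and f :: "circle \<Rightarrow> circle" and F :: "real \<Rightarrow> real"
    and q :: "circle \<Rightarrow> real" and p :: "real \<Rightarrow> real"
  assumes K: "(\<exists>a b. a \<le> 0 \<and> 0 \<le> b \<and> K = {a..b}) \<or> K = {0..} \<or> K = UNIV"
    and f: "continuous_on UNIV f" "has_degree f 1"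
    and F: "lifting f F" "irrational_rotation_set F \<noteq> {}"
    and q: "continuous_on UNIV q" "range q \<subseteq> K"
    and p: "continuous_on K p" "p ` K \<subseteq> K"
    and pq: "\<And>x \<theta>. x \<in> K \<Longrightarrow> p x * q \<theta> \<in> K"
  shows "\<exists>(U :: real \<Rightarrow> circle set) (h :: real \<Rightarrow> circle \<Rightarrow> circle) (\<mu> :: real \<Rightarrow> circle measure).
    (\<forall>\<rho>\<in>irrational_rotation_set F.
       U \<rho> \<in> sets borel \<and> invariant_set f (U \<rho>) \<and>
       continuous_on UNIV (h \<rho>) \<and> nondecreasing_circle_map (h \<rho>) \<and> has_degree (h \<rho>) 1 \<and>
       ergodic_measure f (\<mu> \<rho>)) \<and>
    (\<forall>\<rho>\<in>irrational_rotation_set F.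
       emeasure (\<mu> \<rho>) (U \<rho>) = 1 \<and>
       (\<forall>x\<in>circle_proj -` closure (U \<rho>). rotation_number F x = \<rho>) \<and>
       homeomorphism (U \<rho>) (h \<rho> ` U \<rho>) (h \<rho>) (inv_into (U \<rho>) (h \<rho>)) \<and>
       closure (h \<rho> ` U \<rho>) = UNIV \<and>
       invariant_set (circle_rotation \<rho>) (h \<rho> ` U \<rho>)) \<and>
    disjoint_family_on (\<lambda>\<rho>. closure (U \<rho>)) (irrational_rotation_set F) \<and>
    (\<forall>\<phi> :: real \<Rightarrow> circle \<Rightarrow> real set.
       (\<forall>\<rho>\<in>irrational_rotation_set F.
          generates_attracting_set (circle_rotation \<rho>)
            (skew_prod (circle_rotation \<rho>) p (q \<circ> inv_into (U \<rho>) (h \<rho>))) K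
            (h \<rho> ` U \<rho>) (\<phi> \<rho>)) \<longrightarrow>
       (\<forall>\<rho>\<in>irrational_rotation_set F.
          generates_attracting_set f (skew_prod f p q) K (U \<rho>) (\<phi> \<rho> \<circ> h \<rho>)) \<and>
       (\<not> is_singleton (rotation_set F) \<longrightarrow>
          uncountable {A. attracting_set f (skew_prod f p q) K A}))"
proof -
  note F1 = degree_one_lift_if_has_degree[OF f(2) F(1)]
  let ?I = "irrational_rotation_set F"
  have "\<exists>G H. irrational_semiconjugacy f F G H \<rho>" if "\<rho> \<in> ?I" for \<rho>
    using irrational_semiconjugacy_exists[OF F(1) F1, of \<rho> \<rho> \<rho>] that
    by (simp add: irrational_rotation_set_def)
  then obtain G H where sc: "\<And>\<rho>. \<rho> \<in> ?I \<Longrightarrow> irrational_semiconjugacy f F (G \<rho>) (H \<rho>) \<rho>"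
    by metis
  define U where U_eq: "U \<rho> = irrational_semiconjugacy.support (H \<rho>) \<rho>" for \<rho>
  define h where h_eq: "h \<rho> = irrational_semiconjugacy.h (H \<rho>)" for \<rho>
  define \<mu> where \<mu>_eq: "\<mu> \<rho> = irrational_semiconjugacy.\<mu> (H \<rho>)" for \<rho>
  have dynamics: "U \<rho> \<in> sets borel \<and> invariant_set f (U \<rho>) \<and>
       continuous_on UNIV (h \<rho>) \<and> nondecreasing_circle_map (h \<rho>) \<and> has_degree (h \<rho>) 1 \<and>
       ergodic_measure f (\<mu> \<rho>)" if "\<rho> \<in> ?I" for \<rho>
  proof -
    interpret irrational_semiconjugacy f F "G \<rho>" "H \<rho>" \<rho> by (rule sc[OF that])
    show ?thesis
      unfolding U_eq h_eq \<mu>_eq nondecreasing_circle_map_def has_degree_def of_int_1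
      using support_borel invariant_support continuous_h lifting_h mono_H
        degree_one_lift_add_1[OF H] ergodic by blast
  qed
  have orbit_structure: "emeasure (\<mu> \<rho>) (U \<rho>) = 1 \<and>
       (\<forall>x\<in>circle_proj -` closure (U \<rho>). rotation_number F x = \<rho>) \<and>
       homeomorphism (U \<rho>) (h \<rho> ` U \<rho>) (h \<rho>) (inv_into (U \<rho>) (h \<rho>)) \<and>
       closure (h \<rho> ` U \<rho>) = UNIV \<and>
       invariant_set (circle_rotation \<rho>) (h \<rho> ` U \<rho>)" if "\<rho> \<in> ?I" for \<rho>
  proof -
    interpret irrational_semiconjugacy f F "G \<rho>" "H \<rho>" \<rho> by (rule sc[OF that])
    show ?thesis
      unfolding U_eq h_eq \<mu>_eq
      using emeasure_support rotation_number_closure_support homeomorphism_h closure_image_support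
        invariant_image_support by blast
  qed
  have disj: "disjoint_family_on (\<lambda>\<rho>. closure (U \<rho>)) ?I"
    unfolding disjoint_family_on_def
  proof (intro ballI impI)
    fix \<rho> \<sigma> assume I: "\<rho> \<in> ?I" "\<sigma> \<in> ?I" and ne: "\<rho> \<noteq> \<sigma>"
    have "\<theta> \<notin> closure (U \<sigma>)" if \<theta>: "\<theta> \<in> closure (U \<rho>)" for \<theta>
    proof
      obtain x where x: "\<theta> = circle_proj x" by (rule circle_projE)
      have rot: "rotation_number F x = \<tau>" if "\<tau> \<in> ?I" "\<theta> \<in> closure (U \<tau>)" for \<tau>
        using orbit_structure[OF that(1)] that(2) unfolding x by blast
      assume "\<theta> \<in> closure (U \<sigma>)"
      with ne show False using rot[OF I(1) \<theta>] rot[OF I(2)] by simp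
    qed
    then show "closure (U \<rho>) \<inter> closure (U \<sigma>) = {}" by blast
  qed
  have transfer: "generates_attracting_set f (skew_prod f p q) K (U \<rho>) (\<phi> \<circ> h \<rho>)"
    if "\<rho> \<in> ?I" and "generates_attracting_set (circle_rotation \<rho>)
        (skew_prod (circle_rotation \<rho>) p (q \<circ> inv_into (U \<rho>) (h \<rho>))) K (h \<rho> ` U \<rho>) \<phi>" for \<rho> \<phi>
  proof -
    interpret irrational_semiconjugacy f F "G \<rho>" "H \<rho>" \<rho> by (rule sc[OF that(1)])
    show ?thesis using attracting_set_transfer that(2) pq unfolding U_eq h_eq by blast
  qed
  have many: "uncountable {A. attracting_set f (skew_prod f p q) K A}"
    if gen: "\<forall>\<rho>\<in>?I. generates_attracting_set f (skew_prod f p q) K (U \<rho>) (\<phi> \<rho> \<circ> h \<rho>)"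
      and "\<not> is_singleton (rotation_set F)" for \<phi>
  proof
    let ?A = "\<lambda>\<rho>. closure (graph_corr (U \<rho>) (\<phi> \<rho> \<circ> h \<rho>))"
    assume "countable {A. attracting_set f (skew_prod f p q) K A}"
    moreover have "?A ` ?I \<subseteq> {A. attracting_set f (skew_prod f p q) K A}"
      using gen unfolding attracting_set_def by blast
    ultimately have "countable (?A ` ?I)" by (rule countable_subset[rotated])
    moreover have "inj_on ?A ?I"
    proof (rule inj_on_closure_graph_corr[OF disj])
      fix \<rho> assume I: "\<rho> \<in> ?I"
      interpret irrational_semiconjugacy f F "G \<rho>" "H \<rho>" \<rho> by (rule sc[OF I])
      have "correspondence (U \<rho>) K (\<phi> \<rho> \<circ> h \<rho>)"
        using gen I by (auto simp: generates_attracting_set_def)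
      then show "graph_corr (U \<rho>) (\<phi> \<rho> \<circ> h \<rho>) \<noteq> {}"
        using support_nonempty by (auto simp: U_eq correspondence_def graph_corr_def)
    qed
    ultimately have "countable ?I" by (rule countable_image_inj_on)
    then show False using uncountable_irrational_rotation_set[OF F(1) F1 that(2)] by simp
  qed
  show ?thesis
  proof (rule exI[of _ U], rule exI[of _ h], rule exI[of _ \<mu>], intro conjI allI impI)
    fix \<phi> :: "real \<Rightarrow> circle \<Rightarrow> real set"
    assume S: "\<forall>\<rho>\<in>?I. generates_attracting_set (circle_rotation \<rho>)
        (skew_prod (circle_rotation \<rho>) p (q \<circ> inv_into (U \<rho>) (h \<rho>))) K (h \<rho> ` U \<rho>) (\<phi> \<rho>)"
    show T: "\<forall>\<rho>\<in>?I. generates_attracting_set f (skew_prod f p q) K (U \<rho>) (\<phi> \<rho> \<circ> h \<rho>)"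
    proof
      fix \<rho> assume \<rho>: "\<rho> \<in> ?I"
      show "generates_attracting_set f (skew_prod f p q) K (U \<rho>) (\<phi> \<rho> \<circ> h \<rho>)"
        by (rule transfer[OF \<rho> bspec[OF S \<rho>]])
    qed
    assume "\<not> is_singleton (rotation_set F)"
    with T show "uncountable {A. attracting_set f (skew_prod f p q) K A}" by (rule many)
  qed (rule disj | rule ballI, erule dynamics | rule ballI, erule orbit_structure)+
qed

end
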